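(* Let $\mathcal M_h$ be a mesh of a compact $n$-dimensional Riemannian manifold $\Omega$ for which affine compatible local coordinates $(I_f)_f$ exist (see context), and let the polynomial spaces $\mathcal P_r\Lambda^l(f)$, maps $\kappa_f$ and trimmed polynomial spaces $\mathcal P^-_r\Lambda^l(f)$ on the cells be defined from these coordinates as in the context. Then traces of trimmed polynomials are trimmed polynomials: for all $l\in\mathbb Z$, $d\in[0,n]$, $f\in\Delta_d(\mathcal M_h)$, $d'\in[0,d]$ and $r\ge0$, $$\operatorname{tr}_{f'}\mathcal P^-_r\Lambda^l(f)\subset\mathcal P^-_r\Lambda^l(f')\qquad\forall f'\in\Delta_{d'}(f).$$
   Context: **Mesh.** $\mathcal M_h$ is a finite collection of pairwise disjoint submanifolds ("cells") of dimensions $0,\dots,n$, covering $\Omega$; $\Delta_d(\mathcal M_h)$ is the set of $d$-dimensional cells. If $f$ is a $d$-cell, $d\ge1$, and $f'$ a $d'$-cell with $d'<d$ and $f'\cap\overline f\neq\emptyset$, then $f'\subset\partial f$. For $d'<d$, $\Delta_{d'}(f)$ is the set of $d'$-cells contained in $\partial f$, and $\Delta_d(f)=\{f\}$. **Affine compatible local coordinates.** For all $0\le d\le n$ and $f\in\Delta_d(\mathcal M_h)$ there is a $C^2$-diffeomorphism $I_f:U_f\subset\mathbb R^d\to\overline f$. Moreover, for all $f'\in\Delta_{d-1}(f)$, setting $J_f:=(I_f)^{-1}$ and denoting by $\mathfrak I_{f,f'}:f'\to\overline f$ the inclusion, the mapping $\mathcal T_{f,f'}:=J_f\circ\mathfrak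 I_{f,f'}\circ I_{f'}:U_{f'}\to\mathbb R^d$ is affine. **Polynomial spaces.** $\mathcal P_r\Lambda^l(\mathbb R^d)$ is the space of $l$-forms on $\mathbb R^d$ whose coefficients are polynomials of degree at most $r$ ($\{0\}$ if $r<0$ or $l\notin[0,d]$). For $f\in\Delta_d(\mathcal M_h)$: $\mathcal P_r\Lambda^l(f):=J_f^*\mathcal P_r\Lambda^l(\mathbb R^d)$ and $\kappa_f:=\mathsf i_{X_f}$ (interior product with $X_f$), where $X_f:=(I_f)_*X_d$ and $X_d(\boldsymbol x)=\boldsymbol x$ is the identity vector field on $\mathbb R^d$. **Trimmed spaces.** For $r\ge0$: $\mathcal P^-_r\Lambda^0(f):=\mathcal P_r\Lambda^0(f)$ and $\mathcal P^-_r\Lambda^l(f):=\mathrm d\mathcal P_r\Lambda^{l-1}(f)\oplus\kappa_f\mathcal P_{r-1}\Lambda^{l+1}(f)$ for $l\ge1$. $\operatorname{tr}_{f'}$ is the trace of differential forms on $f'$ (pullback by the inclusion of $f'$ in $\overline f$), with $\operatorname{tr}_{f'}=\mathrm{Id}$ if $f'=f$.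
   Formalization: Formalized with two extra mesh conditions: I_f maps the interior of U_f onto f (no slit cells), and ∂f is covered by cells of dimension below d. Without them an open 3-cube minus a curved arc that is a 1-cell is a counterexample. *)

theory Defs
  imports "HOL-Analysis.Analysis"
begin

section \<open>Calculus on subsets of Euclidean space\<close>

definition C1_open :: "'e::real_normed_vector set \<Rightarrow> ('e \<Rightarrow> 'b::real_normed_vector) \<Rightarrow> bool" where
  "C1_open S G \<longleftrightarrow> open S \<and>
     (\<exists>G' :: 'e \<Rightarrow> 'e \<Rightarrow>\<^sub>L 'b.
        (\<forall>x\<in>S. (G has_derivative blinfun_apply (G' x)) (at x)) \<and> continuous_on S G')"

definition C2_open :: "'e::real_normed_vector set \<Rightarrow> ('e \<Rightarrow> 'b::real_normed_vector) \<Rightarrow> bool" where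
  "C2_open S G \<longleftrightarrow> open S \<and>
     (\<exists>G' :: 'e \<Rightarrow> 'e \<Rightarrow>\<^sub>L 'b.
        (\<forall>x\<in>S. (G has_derivative blinfun_apply (G' x)) (at x)) \<and> C1_open S G')"

text \<open>
  On a set that need not be open (a closed cell, a lower-dimensional slice), being \<open>C\<^sup>2\<close> means
  having local \<open>C\<^sup>2\<close> extensions to open sets of the ambient space, and derivatives are those of
  a local \<open>C\<^sup>1\<close> extension. The value of \<open>deriv_on S F x w\<close> is independent of the extension
  whenever \<open>S\<close> lies in a subspace \<open>E\<close>, \<open>w \<in> E\<close>, and \<open>x\<close> is in the closure of the interior of
  \<open>S\<close> relative to \<open>E\<close>; it is only used in this situation.
\<close>

definition C2_on :: "'e::real_normed_vector set \<Rightarrow> ('e \<Rightarrow> 'b::real_normed_vector) \<Rightarrow> bool" where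
  "C2_on S F \<longleftrightarrow> (\<forall>x\<in>S. \<exists>N G. x \<in> N \<and> C2_open N G \<and> (\<forall>y\<in>N \<inter> S. G y = F y))"

definition deriv_on ::
  "'e::real_normed_vector set \<Rightarrow> ('e \<Rightarrow> 'b::real_normed_vector) \<Rightarrow> 'e \<Rightarrow> 'e \<Rightarrow> 'b" where
  "deriv_on S F x w =
     (THE z. \<exists>N G. x \<in> N \<and> C1_open N G \<and> (\<forall>y\<in>N \<inter> S. G y = F y) \<and>
                   z = frechet_derivative G (at x) w)"

text \<open>
  All dimensions \<open>d \<le> n = CARD('n)\<close> have to live in one type: \<open>\<real>\<^sup>d\<close> is the subspace of
  \<open>real ^ 'n\<close> in which only the first \<open>d\<close> coordinates (in the order of \<open>'n\<close>) may be non-zero.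
\<close>

type_synonym 'n rvec = "(real, 'n) vec"

definition Rd :: "nat \<Rightarrow> 'n::{finite,linorder} rvec set" where
  "Rd d = {x. \<forall>i. d \<le> card {..<i} \<longrightarrow> x $ i = 0}"

definition interior_Rd ::
  "nat \<Rightarrow> 'n::{finite,linorder} rvec set \<Rightarrow> 'n rvec set" where
  "interior_Rd d U = (top_of_set (Rd d)) interior_of U"


section \<open>Riemannian manifolds, meshes and their local coordinates\<close>

type_synonym ('a, 'n) chart = "'a set \<times> ('a \<Rightarrow> 'n rvec)"

text \<open>
  A tangent vector is the family of its components in all the charts of the atlas (with the value
  0 for the charts that do not contain the base point).
\<close>

type_synonym ('a, 'n) tangent = "('a, 'n) chart \<Rightarrow> 'n rvec"

text \<open>
  \<open>pdom f\<close> and \<open>param f\<close> are the set \<open>U\<^sub>f\<close> and the map \<open>I\<^sub>f\<close> from \<open>U\<^sub>f\<close> to the closure of \<open>f\<close>.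
\<close>

record ('a, 'n::finite) meshed_manifold =
  atlas :: "('a, 'n) chart set"
  metric :: "'a \<Rightarrow> ('a, 'n) tangent \<Rightarrow> ('a, 'n) tangent \<Rightarrow> real"
  cells :: "'a set set"
  cdim :: "'a set \<Rightarrow> nat"
  pdom :: "'a set \<Rightarrow> 'n rvec set"
  param :: "'a set \<Rightarrow> 'n rvec \<Rightarrow> 'a"

definition is_chart :: "('a::topological_space, 'n::finite) chart \<Rightarrow> bool" where
  "is_chart c \<longleftrightarrow> (case c of (V, \<phi>) \<Rightarrow>
     open V \<and> open (\<phi> ` V) \<and> homeomorphism V (\<phi> ` V) \<phi> (inv_into V \<phi>))"

definition C2_compatible ::
  "('a::topological_space, 'n::finite) chart \<Rightarrow> ('a, 'n) chart \<Rightarrow> bool" where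
  "C2_compatible c c' \<longleftrightarrow> (case c of (V, \<phi>) \<Rightarrow> case c' of (W, \<psi>) \<Rightarrow>
     C2_on (\<phi> ` (V \<inter> W)) (\<psi> \<circ> inv_into V \<phi>) \<and> C2_on (\<psi> ` (V \<inter> W)) (\<phi> \<circ> inv_into W \<psi>))"

definition is_atlas :: "('a::topological_space, 'n::finite) chart set \<Rightarrow> bool" where
  "is_atlas A \<longleftrightarrow> (\<forall>c\<in>A. is_chart c) \<and> (\<forall>c\<in>A. \<forall>c'\<in>A. C2_compatible c c') \<and>
     (\<Union>c\<in>A. fst c) = UNIV"

definition tangent_vectors ::
  "('a::topological_space, 'n::finite) chart set \<Rightarrow> 'a \<Rightarrow> ('a, 'n) tangent set" where
  "tangent_vectors A p =
     {v. (\<forall>c. c \<notin> A \<or> p \<notin> fst c \<longrightarrow> v c = 0) \<and>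
         (\<forall>V \<phi> W \<psi>. (V, \<phi>) \<in> A \<and> (W, \<psi>) \<in> A \<and> p \<in> V \<inter> W \<longrightarrow>
            v (W, \<psi>) = deriv_on (\<phi> ` (V \<inter> W)) (\<psi> \<circ> inv_into V \<phi>) (\<phi> p) (v (V, \<phi>)))}"

definition is_metric ::
  "('a::topological_space, 'n::finite) chart set \<Rightarrow>
   ('a \<Rightarrow> ('a, 'n) tangent \<Rightarrow> ('a, 'n) tangent \<Rightarrow> real) \<Rightarrow> bool" where
  "is_metric A g \<longleftrightarrow>
     (\<forall>(V, \<phi>)\<in>A. \<exists>G :: 'n rvec \<Rightarrow> real ^ 'n ^ 'n. C1_open (\<phi> ` V) G \<and>
        (\<forall>x\<in>\<phi> ` V. transpose (G x) = G x \<and> (\<forall>w. w \<noteq> 0 \<longrightarrow> w \<bullet> (G x *v w) > 0)) \<and>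
        (\<forall>p\<in>V. \<forall>u\<in>tangent_vectors A p. \<forall>v\<in>tangent_vectors A p.
           g p u v = u (V, \<phi>) \<bullet> (G (\<phi> p) *v v (V, \<phi>))))"

definition compact_riemannian_manifold ::
  "('a::t2_space, 'n::finite, 'z) meshed_manifold_scheme \<Rightarrow> bool" where
  "compact_riemannian_manifold X \<longleftrightarrow>
     compact (UNIV :: 'a set) \<and> is_atlas (atlas X) \<and> is_metric (atlas X) (metric X)"

definition submanifold ::
  "('a::topological_space, 'n::{finite,linorder}) chart set \<Rightarrow> nat \<Rightarrow> 'a set \<Rightarrow> bool" where
  "submanifold A d S \<longleftrightarrow>
     (\<forall>p\<in>S. \<exists>W \<psi>. p \<in> W \<and> is_chart (W, \<psi>) \<and> (\<forall>c\<in>A. C2_compatible c (W, \<psi>)) \<and>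
        \<psi> ` (S \<inter> W) = \<psi> ` W \<inter> Rd d)"

definition bdry :: "'a::topological_space set \<Rightarrow> 'a set" where
  "bdry f = closure f - f"

text \<open>
  The last clause says that the boundary of a cell is made of cells of lower dimension, as in any
  cell complex; it excludes a face of a cell lying inside a cell of the same or a higher dimension.
\<close>

definition is_mesh ::
  "('a::topological_space, 'n::{finite,linorder}, 'z) meshed_manifold_scheme \<Rightarrow> bool" where
  "is_mesh X \<longleftrightarrow>
     finite (cells X) \<and> disjoint (cells X) \<and> \<Union> (cells X) = UNIV \<and>
     (\<forall>f\<in>cells X. cdim X f \<le> CARD('n) \<and> submanifold (atlas X) (cdim X f) f) \<and>
     (\<forall>f\<in>cells X. \<forall>f'\<in>cells X.
        1 \<le> cdim X f \<and> cdim X f' < cdim X f \<and> f' \<inter> closure f \<noteq> {} \<longrightarrow> f' \<subseteq> bdry f) \<and>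
     (\<forall>f\<in>cells X. bdry f \<subseteq> \<Union> {f' \<in> cells X. cdim X f' < cdim X f})"

definition cells_of_dim ::
  "('a, 'n::finite, 'z) meshed_manifold_scheme \<Rightarrow> nat \<Rightarrow> 'a set set" where
  "cells_of_dim X d = {f \<in> cells X. cdim X f = d}"

definition subcells ::
  "('a::topological_space, 'n::finite, 'z) meshed_manifold_scheme \<Rightarrow> nat \<Rightarrow> 'a set \<Rightarrow> 'a set set"
where
  "subcells X d' f = (if d' = cdim X f then {f} else {f' \<in> cells_of_dim X d'. f' \<subseteq> bdry f})"

definition coord :: "('a, 'n::finite, 'z) meshed_manifold_scheme \<Rightarrow> 'a set \<Rightarrow> 'a \<Rightarrow> 'n rvec" where
  "coord X f = inv_into (pdom X f) (param X f)"

text \<open>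
  \<open>I\<^sub>f\<close> is a diffeomorphism of manifolds with (piecewise smooth) boundary: it maps the interior of
  \<open>U\<^sub>f\<close> in \<open>\<real>\<^sup>d\<close> to \<open>f\<close>, hence the frontier of \<open>U\<^sub>f\<close> to \<open>bdry f\<close>. In particular a cell is not
  slit: it does not lie on both sides of a part of its boundary.
\<close>

definition C2_coordinates ::
  "('a::topological_space, 'n::{finite,linorder}, 'z) meshed_manifold_scheme \<Rightarrow> 'a set \<Rightarrow> bool"
where
  "C2_coordinates X f \<longleftrightarrow>
     pdom X f \<subseteq> Rd (cdim X f) \<and>
     homeomorphism (pdom X f) (closure f) (param X f) (coord X f) \<and>
     param X f ` interior_Rd (cdim X f) (pdom X f) = f \<and>
     (\<forall>(V, \<phi>)\<in>atlas X.
        C2_on {x \<in> pdom X f. param X f x \<in> V} (\<phi> \<circ> param X f) \<and>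
        C2_on (\<phi> ` (V \<inter> closure f)) (coord X f \<circ> inv_into V \<phi>))"

definition affine_compatible_coordinates ::
  "('a::topological_space, 'n::{finite,linorder}, 'z) meshed_manifold_scheme \<Rightarrow> bool" where
  "affine_compatible_coordinates X \<longleftrightarrow>
     (\<forall>f\<in>cells X. C2_coordinates X f) \<and>
     (\<forall>f\<in>cells X. \<forall>d'. Suc d' = cdim X f \<longrightarrow> (\<forall>f'\<in>subcells X d' f.
        \<exists>L b. linear L \<and> (\<forall>x\<in>pdom X f'. coord X f (param X f' x) = L x + b)))"


section \<open>Differential forms on Euclidean spaces\<close>

text \<open>
  A form assigns to a point and a list of tangent vectors a real number; \<open>l\<close>-forms take the value
  0 on lists of a length other than \<open>l\<close>, and all forms vanish off their domain.
\<close>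

definition alternating_form ::
  "nat \<Rightarrow> nat \<Rightarrow> ('n::{finite,linorder} rvec list \<Rightarrow> real) \<Rightarrow> bool" where
  "alternating_form d l w \<longleftrightarrow>
     (\<forall>vs. length vs \<noteq> l \<or> \<not> set vs \<subseteq> Rd d \<longrightarrow> w vs = 0) \<and>
     (\<forall>us x y vs c. set (us @ x # y # vs) \<subseteq> Rd d \<and> length (us @ x # vs) = l \<longrightarrow>
        w (us @ (x + c *\<^sub>R y) # vs) = w (us @ x # vs) + c * w (us @ y # vs)) \<and>
     (\<forall>vs. \<not> distinct vs \<longrightarrow> w vs = 0)"

text \<open>
  Restricting to \<open>Rd d\<close> the polynomials in all coordinates gives the polynomials on \<open>\<real>\<^sup>d\<close>. For
  \<open>r < 0\<close> the sum is empty.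
\<close>

definition polynomials :: "int \<Rightarrow> ('n::finite rvec \<Rightarrow> real) set" where
  "polynomials r =
     {p. \<exists>c :: ('n \<Rightarrow> nat) \<Rightarrow> real.
           p = (\<lambda>x. \<Sum>a | int (\<Sum>i\<in>UNIV. a i) \<le> r. c a * (\<Prod>i\<in>UNIV. (x $ i) ^ a i))}"

text \<open>
  The coefficient of \<open>dx\<^sub>j\<^sub>1 \<and> \<dots> \<and> dx\<^sub>j\<^sub>l\<close> in an \<open>l\<close>-form is its value on the corresponding vectors of
  the canonical basis.
\<close>

definition poly_forms ::
  "int \<Rightarrow> int \<Rightarrow> nat \<Rightarrow> ('n::{finite,linorder} rvec \<Rightarrow> 'n rvec list \<Rightarrow> real) set" where
  "poly_forms r l d =
     (if r < 0 \<or> l < 0 \<or> int d < l then {\<lambda>_ _. 0}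
      else {\<alpha>. (\<forall>x. x \<notin> Rd d \<longrightarrow> \<alpha> x = (\<lambda>_. 0)) \<and>
               (\<forall>x\<in>Rd d. alternating_form d (nat l) (\<alpha> x)) \<and>
               (\<forall>js :: 'n list. length js = nat l \<longrightarrow>
                  (\<exists>p\<in>polynomials r. \<forall>x\<in>Rd d. \<alpha> x (map (\<lambda>j. axis j 1) js) = p x))})"

text \<open>
  \<open>d\<alpha>\<^sub>x(v\<^sub>0,\<dots>,v\<^sub>l) = \<Sum>\<^sub>i (-1)\<^sup>i D\<^sub>v\<^sub>i \<alpha>(v\<^sub>0,\<dots>,v\<^sub>l without v\<^sub>i)(x)\<close> for constant vector fields \<open>v\<^sub>i\<close>.
\<close>

definition ext_deriv_Rd ::
  "nat \<Rightarrow> 'n::{finite,linorder} rvec set \<Rightarrow> ('n rvec \<Rightarrow> 'n rvec list \<Rightarrow> real) \<Rightarrow>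
   ('n rvec \<Rightarrow> 'n rvec list \<Rightarrow> real)" where
  "ext_deriv_Rd d U \<alpha> x vs =
     (if x \<in> U \<and> set vs \<subseteq> Rd d
      then \<Sum>i<length vs. (-1) ^ i *
             deriv_on U (\<lambda>y. \<alpha> y (take i vs @ drop (Suc i) vs)) x (vs ! i)
      else 0)"


section \<open>Differential forms on cells\<close>

text \<open>
  Forms on a cell are considered up to its boundary, i.e. at the points of \<open>closure f\<close>, so that
  their traces on the boundary cells make sense. \<open>dparam X f x\<close> is the differential of \<open>I\<^sub>f\<close> at \<open>x\<close>,
  and its range is the tangent space of \<open>closure f\<close>.
\<close>

type_synonym ('a, 'n) form = "'a \<Rightarrow> ('a, 'n) tangent list \<Rightarrow> real"

definition dparam ::
  "('a, 'n::finite, 'z) meshed_manifold_scheme \<Rightarrow> 'a set \<Rightarrow> 'n rvec \<Rightarrow> 'n rvec \<Rightarrow> ('a, 'n) tangent"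
where
  "dparam X f x w = (\<lambda>(V, \<phi>). if (V, \<phi>) \<in> atlas X \<and> param X f x \<in> V
     then deriv_on {y \<in> pdom X f. param X f y \<in> V} (\<phi> \<circ> param X f) x w else 0)"

definition cell_tangent ::
  "('a, 'n::{finite,linorder}, 'z) meshed_manifold_scheme \<Rightarrow> 'a set \<Rightarrow> 'a \<Rightarrow> ('a, 'n) tangent set"
where
  "cell_tangent X f p = dparam X f (coord X f p) ` Rd (cdim X f)"

text \<open>The differential of \<open>J\<^sub>f\<close> at \<open>p\<close>, inverse to that of \<open>I\<^sub>f\<close>.\<close>

definition dcoord ::
  "('a, 'n::{finite,linorder}, 'z) meshed_manifold_scheme \<Rightarrow> 'a set \<Rightarrow> 'a \<Rightarrow> ('a, 'n) tangent \<Rightarrow>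
   'n rvec" where
  "dcoord X f p = inv_into (Rd (cdim X f)) (dparam X f (coord X f p))"

definition pull_coord ::
  "('a::topological_space, 'n::{finite,linorder}, 'z) meshed_manifold_scheme \<Rightarrow> 'a set \<Rightarrow>
   ('n rvec \<Rightarrow> 'n rvec list \<Rightarrow> real) \<Rightarrow> ('a, 'n) form" where
  "pull_coord X f \<alpha> p vs =
     (if p \<in> closure f \<and> set vs \<subseteq> cell_tangent X f p
      then \<alpha> (coord X f p) (map (dcoord X f p) vs) else 0)"

definition pull_param ::
  "('a, 'n::{finite,linorder}, 'z) meshed_manifold_scheme \<Rightarrow> 'a set \<Rightarrow>
   ('a, 'n) form \<Rightarrow> ('n rvec \<Rightarrow> 'n rvec list \<Rightarrow> real)" where
  "pull_param X f \<omega> x ws =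
     (if x \<in> pdom X f \<and> set ws \<subseteq> Rd (cdim X f)
      then \<omega> (param X f x) (map (dparam X f x) ws) else 0)"

text \<open>The exterior derivative on a cell, computed in the chart \<open>J\<^sub>f\<close>.\<close>

definition ext_deriv ::
  "('a::topological_space, 'n::{finite,linorder}, 'z) meshed_manifold_scheme \<Rightarrow> 'a set \<Rightarrow>
   ('a, 'n) form \<Rightarrow> ('a, 'n) form" where
  "ext_deriv X f \<omega> =
     pull_coord X f (ext_deriv_Rd (cdim X f) (pdom X f) (pull_param X f \<omega>))"

definition interior_product ::
  "('a \<Rightarrow> ('a, 'n) tangent) \<Rightarrow> ('a, 'n::finite) form \<Rightarrow> ('a, 'n) form" where
  "interior_product Y \<omega> p vs = \<omega> p (Y p # vs)"

definition radial_field ::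
  "('a, 'n::finite, 'z) meshed_manifold_scheme \<Rightarrow> 'a set \<Rightarrow> 'a \<Rightarrow> ('a, 'n) tangent" where
  "radial_field X f p = dparam X f (coord X f p) (coord X f p)"

definition kappa ::
  "('a, 'n::finite, 'z) meshed_manifold_scheme \<Rightarrow> 'a set \<Rightarrow> ('a, 'n) form \<Rightarrow> ('a, 'n) form" where
  "kappa X f = interior_product (radial_field X f)"

definition cell_poly ::
  "('a::topological_space, 'n::{finite,linorder}, 'z) meshed_manifold_scheme \<Rightarrow> int \<Rightarrow> int \<Rightarrow>
   'a set \<Rightarrow> ('a, 'n) form set" where
  "cell_poly X r l f = pull_coord X f ` poly_forms r l (cdim X f)"

definition trimmed ::
  "('a::topological_space, 'n::{finite,linorder}, 'z) meshed_manifold_scheme \<Rightarrow> int \<Rightarrow> int \<Rightarrow>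
   'a set \<Rightarrow> ('a, 'n) form set" where
  "trimmed X r l f =
     (if l < 0 then {\<lambda>_ _. 0}
      else if l = 0 then cell_poly X r 0 f
      else {(\<lambda>p vs. \<mu> p vs + \<nu> p vs) | \<mu> \<nu>.
              \<mu> \<in> ext_deriv X f ` cell_poly X r (l - 1) f \<and>
              \<nu> \<in> kappa X f ` cell_poly X (r - 1) (l + 1) f})"

text \<open>
  The pullback by the inclusion of \<open>closure f'\<close>: its differential is the inclusion between the
  tangent spaces, which are subspaces of the tangent space of the ambient manifold.
\<close>

definition form_trace ::
  "('a::topological_space, 'n::{finite,linorder}, 'z) meshed_manifold_scheme \<Rightarrow> 'a set \<Rightarrow>
   ('a, 'n) form \<Rightarrow> ('a, 'n) form" where
  "form_trace X f' \<omega> p vs = (if p \<in> closure f' \<and> set vs \<subseteq> cell_tangent X f' p then \<omega> p vs else 0)"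

end

theory Submission
  imports Defs
begin

text \<open>
  In coordinates, the trace on \<open>f'\<close> is the pullback by \<open>T = J\<^sub>f \<circ> I\<^sub>f\<^sub>'\<close>. If \<open>T\<close> is affine,
  \<open>T x = L x + b\<close>, the pullback commutes with \<open>d\<close> and maps \<open>\<kappa> \<beta>\<close> to \<open>\<kappa> T\<^sup>*\<beta> + T\<^sup>*(i\<^sub>b \<beta>)\<close>. The
  last term lies in \<open>P\<^sub>r\<^sub>-\<^sub>1\<Lambda>\<^sup>l\<close>, which is contained in \<open>d P\<^sub>r\<Lambda>\<^sup>l\<^sup>-\<^sup>1 + \<kappa> P\<^sub>r\<^sub>-\<^sub>1\<Lambda>\<^sup>l\<^sup>+\<^sup>1\<close> by the homotopy
  formula \<open>(d \<kappa> + \<kappa> d) \<gamma> = l \<gamma> + D\<^sub>x \<gamma>\<close> and induction on the degree.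

  Affinity is assumed only for faces of codimension one, so \<open>f'\<close> must be reached through a chain of
  facets. The frontier of \<open>U\<^sub>f\<close> separates its interior from its complement; a set made of
  finitely many differentiable images of dimension at most \<open>d - 2\<close> does not, because the cone over
  it from an interior point is negligible. Hence every boundary point lies in the closure of a facet.
\<close>

section \<open>Polynomials\<close>

text \<open>All R^d sit in the single type \<open>real ^ 'n\<close> and forms are 0 off their
  domain, so for d < n a form on R^d need not be differentiable in the ambient space. Derivatives
  are taken along lines inside R^d, or through polynomials that agree with the coefficients there.
  The passage from cells to R^d rests on one fact: every point of U_f, frontier included, is a limit
  of relative interior points. Hence any C^1 extension determines the derivatives along R^d, the
  differential of I_f is injective, and d and kappa on a cell become operators on R^d. The obstacle
  in the geometry is that a cell of codimension at least two is only known to lie in the boundary of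
  f, not in the closure of some facet. The transition maps of such cells are known to be
  differentiable but not yet to be affine, which is why measure zero replaces linear algebra: a
  generic segment from inside U_f to its complement has to cross the frontier, yet avoids all
  low-dimensional cells. As soon as the closure of a facet g meets f', the mesh axiom puts all of f'
  into the boundary of g.\<close>

definition monomial :: "('n::finite \<Rightarrow> nat) \<Rightarrow> 'n rvec \<Rightarrow> real" where
  "monomial a x = (\<Prod>i\<in>UNIV. (x $ i) ^ a i)"

lemma polynomials_def': "polynomials r =
    {p. \<exists>c. p = (\<lambda>x. \<Sum>a | int (sum a UNIV) \<le> r. c a * monomial a x)}"
  by (simp add: polynomials_def monomial_def)

text \<open>A sum over an infinite set is 0 by convention, so \<open>polynomials\<close> has its
  intended meaning only because the total degree bounds each exponent.\<close>

lemma finite_degree_le: "finite {a :: 'n::finite \<Rightarrow> nat. int (sum a UNIV) \<le> r}"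
proof (rule finite_subset)
  have "a i \<le> nat r" if "int (sum a UNIV) \<le> r" for a :: "'n \<Rightarrow> nat" and i
  proof -
    have "a i \<le> sum a UNIV" by (simp add: member_le_sum)
    then show ?thesis using that by linarith
  qed
  then show "{a :: 'n \<Rightarrow> nat. int (sum a UNIV) \<le> r} \<subseteq> PiE UNIV (\<lambda>_. {..nat r})"
    by (auto simp: PiE_def Pi_def simp del: of_nat_sum)
qed (simp add: finite_PiE)

lemma polynomials_monomial:
  assumes "int (sum a UNIV) \<le> r"
  shows "(\<lambda>x. k * monomial a x) \<in> polynomials r"
proof -
  have "(\<Sum>b | int (sum b UNIV) \<le> r. (if b = a then k else 0) * monomial b x) = k * monomial a x"
    for x
    using assms
    by (simp add: finite_degree_le if_distrib[of "\<lambda>u. u * _"] del: of_nat_sum cong: if_cong)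
  then show ?thesis
    unfolding polynomials_def' by (intro CollectI exI[of _ "\<lambda>b. if b = a then k else 0"]) simp
qed

lemma polynomials_add:
  assumes "p \<in> polynomials r" "q \<in> polynomials r"
  shows "(\<lambda>x. p x + q x) \<in> polynomials r"
proof -
  obtain c e where "p = (\<lambda>x. \<Sum>a | int (sum a UNIV) \<le> r. c a * monomial a x)"
    "q = (\<lambda>x. \<Sum>a | int (sum a UNIV) \<le> r. e a * monomial a x)"
    using assms unfolding polynomials_def' by auto
  then show ?thesis
    unfolding polynomials_def'
    by (intro CollectI exI[of _ "\<lambda>a. c a + e a"]) (simp add: sum.distrib distrib_right)
qed

lemma polynomials_scale:
  assumes "p \<in> polynomials r"
  shows "(\<lambda>x. k * p x) \<in> polynomials r"
proof -
  obtain c where "p = (\<lambda>x. \<Sum>a | int (sum a UNIV) \<le> r. c a * monomial a x)"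
    using assms unfolding polynomials_def' by auto
  then show ?thesis
    unfolding polynomials_def'
    by (intro CollectI exI[of _ "\<lambda>a. k * c a"]) (simp add: sum_distrib_left mult.assoc)
qed

lemma polynomials_zero: "(\<lambda>_. 0) \<in> polynomials r"
  unfolding polynomials_def' by (intro CollectI exI[of _ "\<lambda>_. 0"]) simp

lemma polynomials_neg: "r < 0 \<Longrightarrow> p \<in> polynomials r \<Longrightarrow> p x = 0"
  unfolding polynomials_def'
proof clarsimp
  fix c :: "('a \<Rightarrow> nat) \<Rightarrow> real"
  assume "r < 0"
  then have e: "{a :: 'a \<Rightarrow> nat. (\<Sum>i\<in>UNIV. int (a i)) \<le> r} = {}"
    using sum_nonneg[of UNIV "\<lambda>i. int (_ i)"] by (auto simp: not_le intro: less_le_trans)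
  show "(\<Sum>a | (\<Sum>i\<in>UNIV. int (a i)) \<le> r. c a * monomial a x) = 0"
    by (simp only: e sum.empty)
qed

lemma polynomials_sum:
  assumes "\<And>i. i \<in> I \<Longrightarrow> p i \<in> polynomials r"
  shows "(\<lambda>x. \<Sum>i\<in>I. p i x) \<in> polynomials r"
  using assms
  by (induction I rule: infinite_finite_induct) (auto intro: polynomials_zero polynomials_add)

lemma polynomials_mono:
  assumes "p \<in> polynomials r" "r \<le> s"
  shows "p \<in> polynomials s"
proof -
  obtain c where p: "p = (\<lambda>x. \<Sum>a | int (sum a UNIV) \<le> r. c a * monomial a x)"
    using assms unfolding polynomials_def' by auto
  show ?thesis
    unfolding p using assms(2) by (intro polynomials_sum polynomials_monomial) auto
qed

lemma monomial_mult_coordinate: "x $ i * monomial a x = monomial (a(i := Suc (a i))) x"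
proof -
  have "monomial (a(i := Suc (a i))) x
      = x $ i ^ Suc (a i) * (\<Prod>j\<in>UNIV - {i}. (x $ j) ^ (a(i := Suc (a i))) j)"
    unfolding monomial_def by (subst prod.remove[of _ i]) auto
  also have "(\<Prod>j\<in>UNIV - {i}. (x $ j) ^ (a(i := Suc (a i))) j) = (\<Prod>j\<in>UNIV - {i}. (x $ j) ^ a j)"
    by (intro prod.cong) auto
  finally have "monomial (a(i := Suc (a i))) x = x $ i ^ Suc (a i) * (\<Prod>j\<in>UNIV - {i}. (x $ j) ^ a j)" .
  then show ?thesis
    unfolding monomial_def[of a] prod.remove[of UNIV i "\<lambda>i. x $ i ^ a i", simplified]
    by (simp del: fun_upd_apply add: mult.assoc)
qed

lemma sum_fun_upd_Suc: "sum (a(i := Suc (a i))) (UNIV :: 'n::finite set) = Suc (sum a UNIV)"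
proof -
  have "sum (a(i := Suc (a i))) UNIV = Suc (a i) + sum (a(i := Suc (a i))) (UNIV - {i})"
    by (subst sum.remove[of _ i]) auto
  also have "sum (a(i := Suc (a i))) (UNIV - {i}) = sum a (UNIV - {i})"
    by (intro sum.cong) auto
  finally show ?thesis
    unfolding sum.remove[of UNIV i a, simplified] by simp
qed

lemma polynomials_mult_coordinate:
  assumes "p \<in> polynomials r"
  shows "(\<lambda>x. x $ i * p x) \<in> polynomials (r + 1)"
proof -
  obtain c where p: "p = (\<lambda>x. \<Sum>a | int (sum a UNIV) \<le> r. c a * monomial a x)"
    using assms unfolding polynomials_def' by auto
  have "(\<lambda>x. x $ i * p x)
      = (\<lambda>x. \<Sum>a | int (sum a UNIV) \<le> r. c a * monomial (a(i := Suc (a i))) x)"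
    by (simp add: p sum_distrib_left monomial_mult_coordinate[symmetric] ac_simps)
  also have "\<dots> \<in> polynomials (r + 1)"
    by (intro polynomials_sum polynomials_monomial) (auto simp: sum_fun_upd_Suc simp del: of_nat_sum fun_upd_apply)
  finally show ?thesis .
qed

lemma linear_component_expansion:
  fixes L :: "'n::finite rvec \<Rightarrow> 'n rvec"
  assumes "linear L"
  shows "L x $ i = (\<Sum>j\<in>UNIV. x $ j * L (axis j 1) $ i)"
proof -
  have "x = (\<Sum>j\<in>UNIV. x $ j *\<^sub>R axis j 1)"
    by (simp add: vec_eq_iff axis_def if_distrib cong: if_cong)
  then have "L x = (\<Sum>j\<in>UNIV. x $ j *\<^sub>R L (axis j 1))"
    by (metis (no_types, lifting) assms linear_scale linear_sum sum.cong)
  then show ?thesis by simp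
qed

text \<open>The extra factor \<open>p\<close> lets powers of different components be multiplied one
  after another, which is how \<open>polynomials_compose_affine\<close> treats a monomial. An affine
  factor is a combination of coordinates plus a constant, so each one raises the degree bound by
  one.\<close>

lemma polynomials_mult_affine_power:
  fixes L :: "'n::finite rvec \<Rightarrow> 'n rvec"
  assumes L: "linear L" and p: "p \<in> polynomials r"
  shows "(\<lambda>x. (L x $ i + b $ i) ^ k * p x) \<in> polynomials (r + int k)"
proof (induction k)
  case 0
  then show ?case using p by simp
next
  case (Suc k)
  define q where "q = (\<lambda>x. (L x $ i + b $ i) ^ k * p x)"
  have q: "q \<in> polynomials (r + int k)" using Suc by (simp add: q_def)
  have "L x $ i * q x = (\<Sum>j\<in>UNIV. L (axis j 1) $ i * (x $ j * q x))" for x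
    by (subst linear_component_expansion[OF L]) (simp add: sum_distrib_right sum_distrib_left ac_simps)
  then have "(\<lambda>x. (L x $ i + b $ i) ^ Suc k * p x)
      = (\<lambda>x. (\<Sum>j\<in>UNIV. L (axis j 1) $ i * (x $ j * q x)) + b $ i * q x)"
    by (simp add: q_def distrib_right mult.assoc fun_eq_iff)
  also have "\<dots> \<in> polynomials (r + int (Suc k))"
  proof (intro polynomials_add polynomials_sum polynomials_scale)
    show "q \<in> polynomials (r + int (Suc k))" using q by (rule polynomials_mono) simp
    show "(\<lambda>x. x $ j * q x) \<in> polynomials (r + int (Suc k))" for j
      using polynomials_mult_coordinate[OF q, of j] by (simp add: ac_simps)
  qed
  finally show ?case .
qed

lemma polynomials_compose_affine:
  fixes L :: "'n::finite rvec \<Rightarrow> 'n rvec"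
  assumes L: "linear L" and p: "p \<in> polynomials r"
  shows "(\<lambda>x. p (L x + b)) \<in> polynomials r"
proof -
  obtain c where p: "p = (\<lambda>x. \<Sum>a | int (sum a UNIV) \<le> r. c a * monomial a x)"
    using assms unfolding polynomials_def' by auto
  have m: "(\<lambda>x. \<Prod>i\<in>I. (L x $ i + b $ i) ^ a i) \<in> polynomials (int (sum a I))" for I a
  proof (induction I rule: infinite_finite_induct)
    case (insert i I)
    then show ?case
      using polynomials_mult_affine_power[OF L insert.IH, of i b "a i"]
      by (simp add: add.commute[of "int (a i)"])
  qed (use polynomials_monomial[of "\<lambda>_. 0" 0 1] in \<open>auto simp: monomial_def\<close>)
  show ?thesis
    unfolding p monomial_def vector_add_component
    by (intro polynomials_sum polynomials_scale) (rule polynomials_mono[OF m], simp)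
qed

section \<open>Derivatives of polynomials\<close>

lemma monomial_pred: "x $ i * (real (a i) * monomial (a(i := a i - 1)) x) = real (a i) * monomial a x"
\<comment> \<open>For \<open>a i = 0\<close> the subtraction is truncated, but the factor
  \<open>real (a i)\<close> makes both sides 0.\<close>
proof (cases "a i")
  case (Suc k)
  have "a = (a(i := k))(i := Suc ((a(i := k)) i))" using Suc by auto
  then show ?thesis
    using monomial_mult_coordinate[of x i "a(i := k)"] Suc by simp
qed simp

lemma has_derivative_monomial:
  "(monomial a has_derivative (\<lambda>v. \<Sum>i\<in>UNIV. v $ i * (real (a i) * monomial (a(i := a i - 1)) x))) (at x)"
proof -
  have p: "((\<lambda>y. y $ i ^ a i) has_derivative (\<lambda>v. v $ i * (real (a i) * x $ i ^ (a i - 1)))) (at x)"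
    for i
    by (auto intro!: derivative_eq_intros bounded_linear.has_derivative[OF bounded_linear_vec_nth]
        simp: ac_simps)
  have eq: "monomial (a(i := a i - 1)) x = x $ i ^ (a i - 1) * (\<Prod>j\<in>UNIV - {i}. x $ j ^ a j)" for i
  proof -
    have "(\<Prod>j\<in>UNIV - {i}. (x $ j) ^ (a(i := a i - 1)) j) = (\<Prod>j\<in>UNIV - {i}. (x $ j) ^ a j)"
      by (intro prod.cong) auto
    then show ?thesis unfolding monomial_def by (subst prod.remove[of _ i]) auto
  qed
  show ?thesis
    using has_derivative_prod[of UNIV "\<lambda>i y. y $ i ^ a i", OF p]
    unfolding eq by (simp add: monomial_def[abs_def] mult.assoc)
qed

text \<open>The Euler operator multiplies a monomial of degree s by s, so subtracting r times
  \<open>p\<close> removes exactly the terms of degree r. The crude bound r for the partial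
  derivatives is enough: in \<open>pform_koszul_decomposition\<close> the exterior derivative of a
  form of degree k may again have degree k.\<close>

lemma polynomials_has_derivative:
  fixes p :: "'n::finite rvec \<Rightarrow> real"
  assumes "p \<in> polynomials r"
  obtains g :: "'n \<Rightarrow> 'n rvec \<Rightarrow> real" where "\<And>i :: 'n. g i \<in> polynomials r"
    and "\<And>x. (p has_derivative (\<lambda>v. \<Sum>i\<in>UNIV. v $ i * g i x)) (at x)"
    and "(\<lambda>x. (\<Sum>i\<in>UNIV. x $ i * g i x) - of_int r * p x) \<in> polynomials (r - 1)"
proof -
  obtain c where p: "p = (\<lambda>x. \<Sum>a | int (sum a UNIV) \<le> r. c a * monomial a x)"
    using assms unfolding polynomials_def' by auto
  define A where "A = {a :: 'n \<Rightarrow> nat. int (sum a UNIV) \<le> r}"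
  define g where "g i x = (\<Sum>a\<in>A. c a * real (a i) * monomial (a(i := a i - 1)) x)" for i x
  have p': "p = (\<lambda>x. \<Sum>a\<in>A. c a * monomial a x)" by (simp add: p A_def)
  have 1: "g i \<in> polynomials r" for i
    unfolding g_def
  proof (intro polynomials_sum polynomials_monomial)
    fix a assume "a \<in> A"
    moreover have "sum (a(i := a i - 1)) UNIV \<le> sum a UNIV" by (intro sum_mono) auto
    ultimately show "int (sum (a(i := a i - 1)) UNIV) \<le> r"
      unfolding A_def mem_Collect_eq by linarith
  qed
  have g: "(\<Sum>i\<in>UNIV. v $ i * g i x)
    = (\<Sum>a\<in>A. c a * (\<Sum>i\<in>UNIV. v $ i * (real (a i) * monomial (a(i := a i - 1)) x)))" for v x
    unfolding g_def sum_distrib_left by (subst sum.swap) (simp add: ac_simps)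
  have 2: "(p has_derivative (\<lambda>v. \<Sum>i\<in>UNIV. v $ i * g i x)) (at x)" for x
    unfolding p' g
    by (intro has_derivative_sum has_derivative_mult_right has_derivative_monomial)
  have 3: "(\<lambda>x. (\<Sum>i\<in>UNIV. x $ i * g i x) - of_int r * p x)
      = (\<lambda>x. \<Sum>a\<in>A. (c a * (real (sum a UNIV) - of_int r)) * monomial a x)"
  proof
    fix x :: "'n rvec"
    have "(\<Sum>i\<in>UNIV. x $ i * (real (a i) * monomial (a(i := a i - 1)) x)) = real (sum a UNIV) * monomial a x"
      for a
      unfolding monomial_pred by (simp add: sum_distrib_right)
    then show "(\<Sum>i\<in>UNIV. x $ i * g i x) - of_int r * p x
        = (\<Sum>a\<in>A. (c a * (real (sum a UNIV) - of_int r)) * monomial a x)"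
      unfolding g p' by (simp add: sum_distrib_left sum_subtractf algebra_simps del: of_nat_sum)
  qed
  have 4: "(\<lambda>x. (\<Sum>i\<in>UNIV. x $ i * g i x) - of_int r * p x) \<in> polynomials (r - 1)"
    unfolding 3
  proof (intro polynomials_sum)
    fix a assume a: "a \<in> A"
    show "(\<lambda>x. c a * (real (sum a UNIV) - of_int r) * monomial a x) \<in> polynomials (r - 1)"
    proof (cases "int (sum a UNIV) = r")
      case True
      then have "real (sum a UNIV) - of_int r = 0" by (metis diff_self of_int_of_nat_eq)
      then show ?thesis using polynomials_zero by simp
    next
      case False
      then show ?thesis using a by (intro polynomials_monomial) (simp add: A_def)
    qed
  qed
  show ?thesis using that 1 2 4 by blast
qed

lemma polynomials_continuous:
  assumes "p \<in> polynomials r"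
  shows "continuous_on UNIV p"
  by (rule polynomials_has_derivative[OF assms])
    (auto intro!: continuous_at_imp_continuous_on has_derivative_continuous)

lemma C1_open_polynomial:
  fixes p :: "'n::finite rvec \<Rightarrow> real"
  assumes "p \<in> polynomials r"
  shows "C1_open UNIV p"
proof (rule polynomials_has_derivative[OF assms])
  fix g :: "'n \<Rightarrow> 'n rvec \<Rightarrow> real"
  assume g: "\<And>i. g i \<in> polynomials r"
    and d: "\<And>x. (p has_derivative (\<lambda>v. \<Sum>i\<in>UNIV. v $ i * g i x)) (at x)"
  \<comment> \<open>\<open>blinfun_inner_left (axis i 1)\<close> is the i-th coordinate functional,
    so \<open>G x\<close> is the differential as a bounded linear map and inherits continuity from
    the \<open>g i\<close>.\<close>
  define G where "G x = (\<Sum>i\<in>UNIV. g i x *\<^sub>R blinfun_inner_left (axis i (1::real)))" for x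
  have "blinfun_apply (G x) = (\<lambda>v. \<Sum>i\<in>UNIV. v $ i * g i x)" for x
    by (rule ext) (simp add: G_def blinfun.sum_left blinfun.scaleR_left inner_axis mult.commute)
  moreover have "continuous_on UNIV G"
    unfolding G_def
    by (intro continuous_on_sum continuous_on_scaleR polynomials_continuous[OF g] continuous_on_const)
  ultimately show ?thesis
    unfolding C1_open_def using d by (intro conjI exI[of _ G]) auto
qed

section \<open>Alternating forms\<close>

lemma subspace_Rd: "subspace (Rd d)"
  by (auto simp: Rd_def intro!: subspaceI)

lemmas Rd_add = subspace_add[OF subspace_Rd]
lemmas Rd_scale = subspace_scale[OF subspace_Rd]
lemmas Rd_diff = subspace_diff[OF subspace_Rd]
lemmas Rd_0 = subspace_0[OF subspace_Rd]

lemma axis_in_Rd_iff: "axis j (1::real) \<in> Rd d \<longleftrightarrow> card {..<j} < d"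
  by (auto simp: Rd_def axis_def not_le)

lemma inj_rank: "inj (\<lambda>i :: 'n::{finite,linorder}. card {..<i})"
proof (rule strict_mono_imp_inj_on, rule strict_monoI)
  fix i j :: 'n assume "i < j"
  then have "{..<i} \<subset> {..<j}" by auto
  then show "card {..<i} < card {..<j}" by (intro psubset_card_mono) auto
qed

lemma card_rank_less: "card {i :: 'n::{finite,linorder}. card {..<i} < d} \<le> d"
proof -
  have "card {i :: 'n. card {..<i} < d} = card ((\<lambda>i. card {..<i}) ` {i :: 'n. card {..<i} < d})"
    by (metis card_image inj_on_subset inj_rank subset_UNIV)
  also have "\<dots> \<le> card {..<d}" by (intro card_mono) auto
  finally show ?thesis by simp
qed

lemma alternating_form_junk:
  "alternating_form d l w \<Longrightarrow> length vs \<noteq> l \<or> \<not> set vs \<subseteq> Rd d \<Longrightarrow> w vs = 0"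
  unfolding alternating_form_def by blast

lemma alternating_form_linear:
  "alternating_form d l w \<Longrightarrow> set (us @ x # y # vs) \<subseteq> Rd d \<Longrightarrow> length (us @ x # vs) = l \<Longrightarrow>
    w (us @ (x + c *\<^sub>R y) # vs) = w (us @ x # vs) + c * w (us @ y # vs)"
  unfolding alternating_form_def by blast

lemma alternating_form_distinct:
  "alternating_form d l w \<Longrightarrow> \<not> distinct vs \<Longrightarrow> w vs = 0"
  unfolding alternating_form_def by blast

text \<open>Expands the vanishing value on the repeated vector x + y. Off the domain of the form
  both sides are the default value 0.\<close>

lemma alternating_form_swap:
  assumes w: "alternating_form d l w"
  shows "w (us @ x # y # vs) = - w (us @ y # x # vs)"
proof (cases "length (us @ x # y # vs) = l \<and> set (us @ x # y # vs) \<subseteq> Rd d")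
  case True
  then have i: "x \<in> Rd d" "y \<in> Rd d" "set us \<subseteq> Rd d" "set vs \<subseteq> Rd d" by auto
  have s: "x + y \<in> Rd d" using i by (simp add: Rd_add)
  have "0 = w (us @ (x + y) # (x + y) # vs)"
    using alternating_form_distinct[OF w] by auto
  also have "\<dots> = w (us @ x # (x + y) # vs) + w (us @ y # (x + y) # vs)"
    using alternating_form_linear[OF w, of us x y "(x + y) # vs" 1] i s True by simp
  also have "w (us @ x # (x + y) # vs) = w (us @ x # x # vs) + w (us @ x # y # vs)"
    using alternating_form_linear[OF w, of "us @ [x]" x y vs 1] i s True by simp
  also have "w (us @ y # (x + y) # vs) = w (us @ y # x # vs) + w (us @ y # y # vs)"
    using alternating_form_linear[OF w, of "us @ [y]" x y vs 1] i s True by simp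
  also have "w (us @ x # x # vs) = 0"
    using alternating_form_distinct[OF w] by auto
  also have "w (us @ y # y # vs) = 0"
    using alternating_form_distinct[OF w] by auto
  finally show ?thesis by simp
next
  case False
  then have "length (us @ y # x # vs) \<noteq> l \<or> \<not> set (us @ y # x # vs) \<subseteq> Rd d" by auto
  then show ?thesis using False alternating_form_junk[OF w] by (metis minus_zero)
qed

lemma alternating_form_move:
  assumes w: "alternating_form d l w"
  shows "w (us @ v # bs @ cs) = (-1) ^ length bs * w (us @ bs @ v # cs)"
proof (induction bs arbitrary: us)
  case (Cons b bs)
  show ?case
    using alternating_form_swap[OF w, of us v b "bs @ cs"] Cons[of "us @ [b]"] by simp
qed simp

lemma alternating_form_expand:
  assumes w: "alternating_form d l w" and vs: "set (us @ v # vs) \<subseteq> Rd d"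
    and l: "length (us @ v # vs) = l"
  shows "w (us @ v # vs) = (\<Sum>j\<in>UNIV. v $ j * w (us @ axis j 1 # vs))"
proof -
  have v: "v \<in> Rd d" and r: "set us \<subseteq> Rd d" "set vs \<subseteq> Rd d" using vs by auto
  have ax: "v $ j *\<^sub>R axis j 1 \<in> Rd d" for j
    using v by (auto simp: Rd_def axis_def)
  have partial: "w (us @ (\<Sum>j\<in>J. v $ j *\<^sub>R axis j 1) # vs) = (\<Sum>j\<in>J. v $ j * w (us @ axis j 1 # vs))"
    if "finite J" for J
    using that
  proof induction
    case empty
    \<comment> \<open>Linearity with coefficient -1 gives the value 0 at the zero vector v -
      v.\<close>
    have "w (us @ (v + (-1) *\<^sub>R v) # vs) = w (us @ v # vs) + (-1) * w (us @ v # vs)"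
      by (rule alternating_form_linear[OF w]) (use vs l in auto)
    then show ?case by simp
  next
    case (insert j J)
    have s: "(\<Sum>j\<in>J. v $ j *\<^sub>R axis j 1) \<in> Rd d"
      using ax by (intro subspace_sum subspace_Rd)
    show ?case
    proof (cases "axis j (1::real) \<in> Rd d")
      case True
      then have "w (us @ ((\<Sum>j\<in>J. v $ j *\<^sub>R axis j 1) + v $ j *\<^sub>R axis j 1) # vs)
          = w (us @ (\<Sum>j\<in>J. v $ j *\<^sub>R axis j 1) # vs) + v $ j * w (us @ axis j 1 # vs)"
        by (intro alternating_form_linear[OF w]) (use r s l in auto)
      then show ?thesis using insert by (simp add: add.commute)
    next
      case False
      then have "v $ j = 0" using v axis_in_Rd_iff[of j d] by (auto simp: Rd_def)
      then show ?thesis using insert by simp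
    qed
  qed
  have "(\<Sum>j\<in>UNIV. v $ j *\<^sub>R axis j 1) = v"
    by (simp add: vec_eq_iff axis_def if_distrib cong: if_cong)
  then show ?thesis using partial[of UNIV] by simp
qed

lemma alternating_form_zero_on_basis:
  fixes w :: "'n::{finite,linorder} rvec list \<Rightarrow> real"
  assumes w: "alternating_form d l w"
    and z: "\<And>js. length js = l \<Longrightarrow> w (map (\<lambda>j. axis j 1) js) = 0"
  shows "w vs = 0"
proof -
  \<comment> \<open>Induction from the right end of \<open>us\<close>: its last vector is expanded
    over the basis and joins the block of basis vectors behind it.\<close>
  have "w (us @ map (\<lambda>j. axis j 1) js) = 0" for us js
  proof (induction us arbitrary: js rule: rev_induct)
    case Nil
    then show ?case using z alternating_form_junk[OF w] by (cases "length js = l") auto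
  next
    case (snoc v us)
    show ?case
    proof (cases "set (us @ v # map (\<lambda>j. axis j 1) js) \<subseteq> Rd d \<and>
        length (us @ v # map (\<lambda>j. axis j (1::real)) js) = l")
      case True
      then show ?thesis
        using alternating_form_expand[OF w, of us v "map (\<lambda>j. axis j 1) js"] snoc[of "_ # js"]
        by simp
    next
      case False
      then show ?thesis
        using alternating_form_junk[OF w, of "us @ v # map (\<lambda>j. axis j 1) js"] by auto
    qed
  qed
  from this[of vs "[]"] show ?thesis by simp
qed

text \<open>Pigeonhole on the basis: at most d axis vectors lie in \<open>Rd d\<close>, so a list of
  l > d of them repeats a vector or leaves the subspace.\<close>

lemma alternating_form_degree_gt:
  fixes w :: "'n::{finite,linorder} rvec list \<Rightarrow> real"
  assumes w: "alternating_form d l w" and "d < l"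
  shows "w vs = 0"
proof (rule alternating_form_zero_on_basis[OF w])
  fix js :: "'n list"
  assume l: "length js = l"
  show "w (map (\<lambda>j. axis j 1) js) = 0"
  proof (cases "set js \<subseteq> {i. card {..<i} < d}")
    case True
    then have "card (set js) \<le> d"
      using card_rank_less[of d, where 'n = 'n] card_mono[OF _ True] by (meson finite le_trans)
    then have "\<not> distinct js" using l \<open>d < l\<close> distinct_card by fastforce
    then show ?thesis
      by (intro alternating_form_distinct[OF w]) (auto simp: distinct_map)
  next
    case False
    then show ?thesis
      by (intro alternating_form_junk[OF w]) (auto simp: axis_in_Rd_iff)
  qed
qed

section \<open>Polynomial forms\<close>

text \<open>
  The spaces \<open>poly_forms\<close> without the case distinction, and with polynomial values on all
  lists of vectors instead of the basis vectors only.
\<close>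

definition pform :: "int \<Rightarrow> nat \<Rightarrow> nat \<Rightarrow> ('n::{finite,linorder} rvec \<Rightarrow> 'n rvec list \<Rightarrow> real) set" where
  "pform r l d = {\<alpha>. (\<forall>x. x \<notin> Rd d \<longrightarrow> \<alpha> x = (\<lambda>_. 0)) \<and>
     (\<forall>x\<in>Rd d. alternating_form d l (\<alpha> x)) \<and>
     (\<forall>vs. \<exists>p\<in>polynomials r. \<forall>x\<in>Rd d. \<alpha> x vs = p x)}"

lemma pform_off: "\<alpha> \<in> pform r l d \<Longrightarrow> x \<notin> Rd d \<Longrightarrow> \<alpha> x vs = 0"
  by (simp add: pform_def)

lemma pform_alternating: "\<alpha> \<in> pform r l d \<Longrightarrow> x \<in> Rd d \<Longrightarrow> alternating_form d l (\<alpha> x)"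
  by (simp add: pform_def)

lemma pform_junk: "\<alpha> \<in> pform r l d \<Longrightarrow> length vs \<noteq> l \<or> \<not> set vs \<subseteq> Rd d \<Longrightarrow> \<alpha> x vs = 0"
  using alternating_form_junk pform_alternating pform_off by metis

lemma pform_polynomial:
  "\<alpha> \<in> pform r l d \<Longrightarrow> \<exists>p\<in>polynomials r. \<forall>x\<in>Rd d. \<alpha> x vs = p x"
  by (simp add: pform_def)

lemma alternating_form_zero: "alternating_form d l (\<lambda>_. 0)"
  by (simp add: alternating_form_def)

lemma alternating_form_add:
  "alternating_form d l u \<Longrightarrow> alternating_form d l w \<Longrightarrow> alternating_form d l (\<lambda>vs. a * u vs + b * w vs)"
  unfolding alternating_form_def by (simp add: algebra_simps)

lemma pform_zero: "(\<lambda>_ _. 0) \<in> pform r l d"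
  using polynomials_zero by (fastforce simp: pform_def alternating_form_zero)

lemma pform_combine:
  assumes "\<alpha> \<in> pform r l d" "\<beta> \<in> pform r l d"
  shows "(\<lambda>x vs. a * \<alpha> x vs + b * \<beta> x vs) \<in> pform r l d"
proof -
  have "\<exists>p\<in>polynomials r. \<forall>x\<in>Rd d. a * \<alpha> x vs + b * \<beta> x vs = p x" for vs
  proof -
    obtain p q where "p \<in> polynomials r" "q \<in> polynomials r"
      "\<forall>x\<in>Rd d. \<alpha> x vs = p x" "\<forall>x\<in>Rd d. \<beta> x vs = q x"
      using pform_polynomial[OF assms(1)] pform_polynomial[OF assms(2)] by blast
    then show ?thesis
      by (intro bexI[of _ "\<lambda>x. a * p x + b * q x"] polynomials_add polynomials_scale) auto
  qed
  then show ?thesis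
    using assms unfolding pform_def by (auto intro: alternating_form_add)
qed

lemma pform_mono: "\<alpha> \<in> pform r l d \<Longrightarrow> r \<le> s \<Longrightarrow> \<alpha> \<in> pform s l d"
  unfolding pform_def using polynomials_mono by blast

lemma pform_negative: "\<alpha> \<in> pform r l d \<Longrightarrow> r < 0 \<Longrightarrow> \<alpha> x vs = 0"
  using pform_polynomial[of \<alpha> r l d vs] polynomials_neg pform_off by metis

lemma pform_degree_gt: "\<alpha> \<in> pform r l d \<Longrightarrow> d < l \<Longrightarrow> \<alpha> x vs = 0"
  using alternating_form_degree_gt pform_alternating pform_off by metis

text \<open>Polynomiality spreads from basis vectors to all lists because the coordinates of the
  inserted vectors are constants; the induction is that of
  \<open>alternating_form_zero_on_basis\<close>.\<close>

lemma polynomial_coefficients: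
  fixes \<alpha> :: "'n::{finite,linorder} rvec \<Rightarrow> 'n rvec list \<Rightarrow> real"
  assumes a: "\<And>x. x \<in> Rd d \<Longrightarrow> alternating_form d l (\<alpha> x)"
    and p: "\<And>js :: 'n list. length js = l \<Longrightarrow>
      \<exists>p\<in>polynomials r. \<forall>x\<in>Rd d. \<alpha> x (map (\<lambda>j. axis j 1) js) = p x"
  shows "\<exists>p\<in>polynomials r. \<forall>x\<in>Rd d. \<alpha> x vs = p x"
proof -
  have junk: "\<exists>p\<in>polynomials r. \<forall>x\<in>Rd d. \<alpha> x vs = p x"
    if "length vs \<noteq> l \<or> \<not> set vs \<subseteq> Rd d" for vs
    using alternating_form_junk[OF a that] polynomials_zero by (intro bexI[of _ "\<lambda>_. 0"]) auto
  have "\<exists>p\<in>polynomials r. \<forall>x\<in>Rd d. \<alpha> x (us @ map (\<lambda>j. axis j 1) js) = p x" for us and js :: "'n list"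
  proof (induction us arbitrary: js rule: rev_induct)
    case Nil
    then show ?case using p[of js] junk[of "map (\<lambda>j. axis j 1) js"] by (cases "length js = l") auto
  next
    case (snoc v us)
    let ?vs = "map (\<lambda>j. axis j (1::real)) js"
    show ?case
    proof (cases "set (us @ v # ?vs) \<subseteq> Rd d \<and> length (us @ v # ?vs) = l")
      case True
      have "\<exists>p\<in>polynomials r. \<forall>x\<in>Rd d. \<alpha> x (us @ axis j 1 # ?vs) = p x" for j
        using snoc[of "j # js"] by simp
      then obtain P where P: "\<And>j. P j \<in> polynomials r"
        "\<And>j x. x \<in> Rd d \<Longrightarrow> \<alpha> x (us @ axis j 1 # ?vs) = P j x" by metis
      show ?thesis
        using alternating_form_expand[OF a, of _ us v ?vs] True P
        by (intro bexI[of _ "\<lambda>x. \<Sum>j\<in>UNIV. v $ j * P j x"] polynomials_sum polynomials_scale) auto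
    next
      case False
      then show ?thesis using junk[of "us @ v # ?vs"] by auto
    qed
  qed
  from this[of vs "[]"] show ?thesis by simp
qed

text \<open>Where \<open>poly_forms\<close> is zero by fiat, \<open>pform\<close> is zero by itself:
  the only polynomial of negative degree is 0, and alternating forms of degree above d
  vanish.\<close>

lemma poly_forms_eq_pform: "poly_forms r (int l) d = pform r l d"
proof (cases "r < 0 \<or> d < l")
  case True
  then have "\<alpha> = (\<lambda>_ _. 0)" if "\<alpha> \<in> pform r l d" for \<alpha> :: "'a rvec \<Rightarrow> 'a rvec list \<Rightarrow> real"
    using pform_negative[OF that] pform_degree_gt[OF that] by (auto simp: fun_eq_iff)
  then show ?thesis using True pform_zero by (auto simp: poly_forms_def)
next
  case False
  show ?thesis
  proof (intro equalityI subsetI)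
    fix \<alpha> :: "'a rvec \<Rightarrow> 'a rvec list \<Rightarrow> real"
    assume "\<alpha> \<in> poly_forms r (int l) d"
    then show "\<alpha> \<in> pform r l d"
      using False polynomial_coefficients[of d l \<alpha> r] by (auto simp: poly_forms_def pform_def)
  next
    fix \<alpha> :: "'a rvec \<Rightarrow> 'a rvec list \<Rightarrow> real"
    assume "\<alpha> \<in> pform r l d"
    then show "\<alpha> \<in> poly_forms r (int l) d"
      using False by (auto simp: poly_forms_def pform_def)
  qed
qed

section \<open>The exterior derivative and the Koszul operator on polynomial forms\<close>

text \<open>A derivative along a line sees only values on R^d when x and v lie there; the ambient
  derivative may not exist, since forms jump to 0 off R^d.\<close>

definition dird :: "('n::finite rvec \<Rightarrow> 'n rvec list \<Rightarrow> real) \<Rightarrow> 'n rvec \<Rightarrow> 'n rvec \<Rightarrow> 'n rvec list \<Rightarrow> real"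
  where "dird \<alpha> x v vs = deriv (\<lambda>t. \<alpha> (x + t *\<^sub>R v) vs) 0"

definition omit :: "nat \<Rightarrow> 'b list \<Rightarrow> 'b list" where
  "omit i vs = take i vs @ drop (Suc i) vs"

definition extd :: "nat \<Rightarrow> ('n::{finite,linorder} rvec \<Rightarrow> 'n rvec list \<Rightarrow> real) \<Rightarrow>
    'n rvec \<Rightarrow> 'n rvec list \<Rightarrow> real" where
  "extd d \<alpha> x vs = (if x \<in> Rd d \<and> set vs \<subseteq> Rd d
     then \<Sum>i<length vs. (-1) ^ i * dird \<alpha> x (vs ! i) (omit i vs) else 0)"

definition koszul :: "('n::finite rvec \<Rightarrow> 'n rvec list \<Rightarrow> real) \<Rightarrow> 'n rvec \<Rightarrow> 'n rvec list \<Rightarrow> real" where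
  "koszul \<alpha> x vs = \<alpha> x (x # vs)"

lemma has_real_derivative_along_line:
  assumes "(p has_derivative D) (at x)" and "x \<in> Rd d" "v \<in> Rd d" and "\<And>y. y \<in> Rd d \<Longrightarrow> a y = p y"
  shows "((\<lambda>t. a (x + t *\<^sub>R v)) has_real_derivative D v) (at 0)"
proof -
  interpret D: bounded_linear D using assms(1) by (rule has_derivative_bounded_linear)
  have "((\<lambda>t. p (x + t *\<^sub>R v)) has_derivative (\<lambda>t. D (t *\<^sub>R v))) (at 0)"
    by (rule has_derivative_compose[of "\<lambda>t. x + t *\<^sub>R v" "\<lambda>t. t *\<^sub>R v"])
      (use assms(1) in \<open>auto intro!: derivative_eq_intros\<close>)
  then have "((\<lambda>t. p (x + t *\<^sub>R v)) has_real_derivative D v) (at 0)"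
    by (simp add: has_field_derivative_def D.scaleR mult.commute[of _ "D v"])
  moreover have "a (x + t *\<^sub>R v) = p (x + t *\<^sub>R v)" for t
    using assms by (simp add: Rd_add Rd_scale)
  ultimately show ?thesis by simp
qed

text \<open>Value, gradient and Euler identity are delivered together so that all of them refer to
  the same representing polynomial.\<close>

lemma pform_gradient:
  fixes \<alpha> :: "'n::{finite,linorder} rvec \<Rightarrow> 'n rvec list \<Rightarrow> real"
  assumes "\<alpha> \<in> pform r l d"
  obtains p and g :: "'n \<Rightarrow> 'n rvec \<Rightarrow> real" where "p \<in> polynomials r" "\<And>i :: 'n. g i \<in> polynomials r"
    and "\<And>x. x \<in> Rd d \<Longrightarrow> \<alpha> x vs = p x"
    and "\<And>x. (p has_derivative (\<lambda>v. \<Sum>i\<in>UNIV. v $ i * g i x)) (at x)"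
    and "\<And>x v. x \<in> Rd d \<Longrightarrow> v \<in> Rd d \<Longrightarrow> dird \<alpha> x v vs = (\<Sum>i\<in>UNIV. v $ i * g i x)"
    and "(\<lambda>x. (\<Sum>i\<in>UNIV. x $ i * g i x) - of_int r * p x) \<in> polynomials (r - 1)"
proof -
  obtain p where p: "p \<in> polynomials r" "\<And>x. x \<in> Rd d \<Longrightarrow> \<alpha> x vs = p x"
    using pform_polynomial[OF assms] by blast
  show thesis
  proof (rule polynomials_has_derivative[OF p(1)])
    fix g :: "'n \<Rightarrow> 'n rvec \<Rightarrow> real"
    assume g: "\<And>i. g i \<in> polynomials r"
      "\<And>x. (p has_derivative (\<lambda>v. \<Sum>i\<in>UNIV. v $ i * g i x)) (at x)"
      "(\<lambda>x. (\<Sum>i\<in>UNIV. x $ i * g i x) - of_int r * p x) \<in> polynomials (r - 1)"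
    have "dird \<alpha> x v vs = (\<Sum>i\<in>UNIV. v $ i * g i x)" if "x \<in> Rd d" "v \<in> Rd d" for x v
      unfolding dird_def
      using has_real_derivative_along_line[OF g(2) that, of "\<lambda>y. \<alpha> y vs"] p(2)
      by (intro DERIV_imp_deriv) blast
    then show thesis using p g that[of p g] by simp
  qed
qed

lemma pform_has_real_derivative:
  assumes "\<alpha> \<in> pform r l d" "x \<in> Rd d" "v \<in> Rd d"
  shows "((\<lambda>t. \<alpha> (x + t *\<^sub>R v) vs) has_real_derivative dird \<alpha> x v vs) (at 0)"
proof (rule pform_gradient[OF assms(1), of vs])
  fix p and g :: "'a \<Rightarrow> 'a rvec \<Rightarrow> real"
  assume p: "\<And>x. x \<in> Rd d \<Longrightarrow> \<alpha> x vs = p x"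
    and "\<And>x. (p has_derivative (\<lambda>v. \<Sum>i\<in>UNIV. v $ i * g i x)) (at x)"
  from this(2)[of x] have "((\<lambda>t. \<alpha> (x + t *\<^sub>R v) vs) has_real_derivative (\<Sum>i\<in>UNIV. v $ i * g i x)) (at 0)"
    by (rule has_real_derivative_along_line[OF _ assms(2,3)]) (rule p)
  then show ?thesis unfolding dird_def by (simp add: DERIV_imp_deriv)
qed

lemma dird_cong: "(\<And>t. \<alpha> (x + t *\<^sub>R v) vs = \<beta> (y + t *\<^sub>R u) ws) \<Longrightarrow> dird \<alpha> x v vs = dird \<beta> y u ws"
  by (simp add: dird_def)

lemma alternating_form_dird:
  assumes a: "\<alpha> \<in> pform r l d" and x: "x \<in> Rd d" "v \<in> Rd d"
  shows "alternating_form d l (dird \<alpha> x v)"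
proof -
  have alt: "alternating_form d l (\<alpha> (x + t *\<^sub>R v))" for t
    using pform_alternating[OF a] x by (simp add: Rd_add Rd_scale)
  have z: "dird \<alpha> x v vs = 0" if "\<And>t. \<alpha> (x + t *\<^sub>R v) vs = 0" for vs
    using that by (simp add: dird_def)
  show ?thesis
    unfolding alternating_form_def
  proof (intro conjI allI impI)
    fix vs :: "'a rvec list" assume "length vs \<noteq> l \<or> \<not> set vs \<subseteq> Rd d"
    then show "dird \<alpha> x v vs = 0" using alternating_form_junk[OF alt] z by blast
  next
    fix vs :: "'a rvec list" assume "\<not> distinct vs"
    then show "dird \<alpha> x v vs = 0" using alternating_form_distinct[OF alt] z by blast
  next
    fix us vs :: "'a rvec list" and y z c
    assume *: "set (us @ y # z # vs) \<subseteq> Rd d \<and> length (us @ y # vs) = l"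
    have "\<alpha> (x + t *\<^sub>R v) (us @ (y + c *\<^sub>R z) # vs)
        = \<alpha> (x + t *\<^sub>R v) (us @ y # vs) + c * \<alpha> (x + t *\<^sub>R v) (us @ z # vs)" for t
      using alternating_form_linear[OF alt] * by blast
    then have "((\<lambda>t. \<alpha> (x + t *\<^sub>R v) (us @ (y + c *\<^sub>R z) # vs)) has_real_derivative
        dird \<alpha> x v (us @ y # vs) + c * dird \<alpha> x v (us @ z # vs)) (at 0)"
      by (auto intro!: derivative_eq_intros pform_has_real_derivative[OF a x])
    then show "dird \<alpha> x v (us @ (y + c *\<^sub>R z) # vs)
        = dird \<alpha> x v (us @ y # vs) + c * dird \<alpha> x v (us @ z # vs)"
      unfolding dird_def[of \<alpha> x v "us @ (y + c *\<^sub>R z) # vs"] by (rule DERIV_imp_deriv)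
  qed
qed

lemma dird_linear:
  assumes "\<alpha> \<in> pform r l d" "x \<in> Rd d" "u \<in> Rd d" "v \<in> Rd d"
  shows "dird \<alpha> x (u + c *\<^sub>R v) vs = dird \<alpha> x u vs + c * dird \<alpha> x v vs"
proof (rule pform_gradient[OF assms(1), of vs])
  fix g :: "'a \<Rightarrow> 'a rvec \<Rightarrow> real"
  assume g: "\<And>x v. x \<in> Rd d \<Longrightarrow> v \<in> Rd d \<Longrightarrow> dird \<alpha> x v vs = (\<Sum>i\<in>UNIV. v $ i * g i x)"
  show ?thesis
    using assms by (simp add: g Rd_add Rd_scale sum_distrib_left sum.distrib[symmetric] algebra_simps)
qed

lemma dird_combine:
  assumes "\<alpha> \<in> pform r l d" "\<beta> \<in> pform r' l d" "x \<in> Rd d" "v \<in> Rd d"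
  shows "dird (\<lambda>x vs. a * \<alpha> x vs + b * \<beta> x vs) x v vs = a * dird \<alpha> x v vs + b * dird \<beta> x v vs"
  unfolding dird_def[of "\<lambda>x vs. a * \<alpha> x vs + b * \<beta> x vs"]
  by (rule DERIV_imp_deriv)
    (auto intro!: derivative_eq_intros pform_has_real_derivative assms)

lemma extd_combine:
  assumes "\<alpha> \<in> pform r l d" "\<beta> \<in> pform r' l d"
  shows "extd d (\<lambda>x vs. a * \<alpha> x vs + b * \<beta> x vs) x vs = a * extd d \<alpha> x vs + b * extd d \<beta> x vs"
proof (cases "x \<in> Rd d \<and> set vs \<subseteq> Rd d")
  case True
  have "dird (\<lambda>x vs. a * \<alpha> x vs + b * \<beta> x vs) x (vs ! i) (omit i vs)
      = a * dird \<alpha> x (vs ! i) (omit i vs) + b * dird \<beta> x (vs ! i) (omit i vs)" if "i < length vs" for i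
    by (rule dird_combine[OF assms]) (use True that in auto)
  then show ?thesis
    using True by (simp add: extd_def sum_distrib_left sum.distrib[symmetric] algebra_simps)
qed (auto simp: extd_def)

lemma set_omit: "set (omit i vs) \<subseteq> set vs"
  unfolding omit_def using set_take_subset set_drop_subset by fastforce

lemma length_omit: "i < length vs \<Longrightarrow> length (omit i vs) = length vs - 1"
  by (simp add: omit_def)

lemma omit_append_left: "i < length us \<Longrightarrow> omit i (us @ vs) = omit i us @ vs"
  by (simp add: omit_def)

lemma omit_append_right: "omit (length us + i) (us @ vs) = us @ omit i vs"
  by (simp add: omit_def)

lemma omit_0: "omit 0 (v # vs) = vs"
  by (simp add: omit_def)

lemma omit_Suc: "omit (Suc i) (v # vs) = v # omit i vs"
  by (simp add: omit_def)

lemma sum_lessThan_add: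
  fixes f :: "nat \<Rightarrow> real"
  shows "(\<Sum>i<m + n. f i) = (\<Sum>i<m. f i) + (\<Sum>i<n. f (m + i))"
  by (induction n) auto

text \<open>Cuts the sum at the slot of v, so that the term of the exterior derivative that omits v
  stands apart from those that keep it.\<close>

lemma sum_split_position:
  fixes f :: "nat \<Rightarrow> real"
  shows "(\<Sum>i<length (us @ v # vs). f i)
    = (\<Sum>i<length us. f i) + (f (length us) + (\<Sum>i<length vs. f (length us + Suc i)))"
proof -
  have "(\<Sum>i<length (us @ v # vs). f i) = (\<Sum>i<length us + Suc (length vs). f i)" by simp
  also have "\<dots> = (\<Sum>i<length us. f i) + (\<Sum>i<Suc (length vs). f (length us + i))"
    by (rule sum_lessThan_add)
  finally show ?thesis by (simp add: sum.lessThan_Suc_shift del: sum.lessThan_Suc)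
qed

text \<open>Linearity in a slot: the term omitting that slot is linear in the direction of
  differentiation, the others are linear in the form. If v occurs twice, with \<open>bs\<close> in
  between, all terms keeping both copies vanish. The two remaining ones agree up to moving v past
  \<open>bs\<close>, which costs (-1)^|bs|, while their positions differ by |bs| + 1; so they
  cancel.\<close>

lemma alternating_form_extd:
  assumes a: "\<alpha> \<in> pform r l d" and x: "x \<in> Rd d"
  shows "alternating_form d (Suc l) (extd d \<alpha> x)"
  unfolding alternating_form_def
proof (intro conjI allI impI)
  fix vs :: "'a rvec list" assume *: "length vs \<noteq> Suc l \<or> \<not> set vs \<subseteq> Rd d"
  show "extd d \<alpha> x vs = 0"
  proof (cases "set vs \<subseteq> Rd d")
    case True
    have "dird \<alpha> x (vs ! i) (omit i vs) = 0" if "i < length vs" for i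
    proof -
      have "vs ! i \<in> Rd d" using True that by auto
      then show ?thesis
        using alternating_form_junk[OF alternating_form_dird[OF a x]] length_omit[OF that] * True that
        by (metis Suc_pred' bot_nat_0.not_eq_extremum less_nat_zero_code)
    qed
    then show ?thesis by (simp add: extd_def)
  qed (simp add: extd_def)
next
  fix us vs :: "'a rvec list" and y z c
  assume *: "set (us @ y # z # vs) \<subseteq> Rd d \<and> length (us @ y # vs) = Suc l"
  then have R: "y \<in> Rd d" "z \<in> Rd d" "set us \<subseteq> Rd d" "set vs \<subseteq> Rd d"
    and len: "length us + length vs = l" by auto
  have yz: "y + c *\<^sub>R z \<in> Rd d" using R by (simp add: Rd_add Rd_scale)
  note lin = alternating_form_linear[OF alternating_form_dird[OF a x]]
  have e: "extd d \<alpha> x (us @ w # vs) =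
      (\<Sum>i<length us. (-1) ^ i * dird \<alpha> x (us ! i) (omit i us @ w # vs)) +
      ((-1) ^ length us * dird \<alpha> x w (us @ vs) +
       (\<Sum>i<length vs. (-1) ^ (length us + Suc i) * dird \<alpha> x (vs ! i) (us @ w # omit i vs)))"
    if "w \<in> Rd d" for w
    using R that x
    unfolding extd_def sum_split_position omit_append_right omit_Suc
    by (auto simp: omit_append_left nth_append omit_append_right[of us 0, simplified] omit_0)
  have 1: "dird \<alpha> x (us ! i) (omit i us @ (y + c *\<^sub>R z) # vs)
      = dird \<alpha> x (us ! i) (omit i us @ y # vs) + c * dird \<alpha> x (us ! i) (omit i us @ z # vs)"
    if "i < length us" for i
  proof (rule lin)
    show "us ! i \<in> Rd d" using that R by auto
    show "set (omit i us @ y # z # vs) \<subseteq> Rd d" using R set_omit[of i us] by auto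
    show "length (omit i us @ y # vs) = l" using that len by (simp add: length_omit)
  qed
  have 2: "dird \<alpha> x (vs ! i) (us @ (y + c *\<^sub>R z) # omit i vs)
      = dird \<alpha> x (vs ! i) (us @ y # omit i vs) + c * dird \<alpha> x (vs ! i) (us @ z # omit i vs)"
    if "i < length vs" for i
  proof (rule lin)
    show "vs ! i \<in> Rd d" using that R by auto
    show "set (us @ y # z # omit i vs) \<subseteq> Rd d" using R set_omit[of i vs] by auto
    show "length (us @ y # omit i vs) = l" using that len by (simp add: length_omit)
  qed
  show "extd d \<alpha> x (us @ (y + c *\<^sub>R z) # vs) = extd d \<alpha> x (us @ y # vs) + c * extd d \<alpha> x (us @ z # vs)"
    unfolding e[OF R(1)] e[OF R(2)] e[OF yz] dird_linear[OF a x R(1,2)]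
    by (simp add: 1 2 sum_distrib_left sum.distrib sum_subtractf sum_negf algebra_simps)
next
  fix vs :: "'a rvec list" assume "\<not> distinct vs"
  then obtain as v bs cs where vs: "vs = as @ v # bs @ v # cs"
    using not_distinct_decomp by force
  show "extd d \<alpha> x vs = 0"
  proof (cases "set vs \<subseteq> Rd d")
    case True
    then have R: "v \<in> Rd d" "set as \<subseteq> Rd d" "set bs \<subseteq> Rd d" "set cs \<subseteq> Rd d" by (auto simp: vs)
    note D = alternating_form_dird[OF a x]
    have 1: "dird \<alpha> x (as ! i) (omit i as @ v # bs @ v # cs) = 0" if "i < length as" for i
      by (rule alternating_form_distinct[OF D]) (use that R in auto)
    have 2: "dird \<alpha> x (bs ! i) (as @ v # omit i bs @ v # cs) = 0" if "i < length bs" for i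
      by (rule alternating_form_distinct[OF D]) (use that R in auto)
    have 3: "dird \<alpha> x (cs ! i) (as @ v # bs @ v # omit i cs) = 0" if "i < length cs" for i
      by (rule alternating_form_distinct[OF D]) (use that R in auto)
    define f where "f i = (-1) ^ i * dird \<alpha> x (vs ! i) (omit i vs)" for i
    have o: "omit (length as + i) vs = as @ omit i (v # bs @ v # cs)" for i
      by (simp add: vs omit_append_right)
    have n: "vs ! (length as + i) = (v # bs @ v # cs) ! i" for i
      by (simp add: vs)
    have "(\<Sum>i<length vs. f i) = (\<Sum>i<length as. f i) + (f (length as) +
        (\<Sum>i<length (bs @ v # cs). f (length as + Suc i)))"
      using sum_split_position[of f as v "bs @ v # cs"] by (simp add: vs)
    also have "(\<Sum>i<length as. f i) = 0"
      by (intro sum.neutral) (simp add: f_def vs omit_append_left nth_append 1)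
    also have "f (length as) = (-1) ^ length as * dird \<alpha> x v (as @ bs @ v # cs)"
      using o[of 0] n[of 0] by (simp add: f_def omit_0)
    also have "(\<Sum>i<length (bs @ v # cs). f (length as + Suc i)) = 
       (\<Sum>i<length bs. f (length as + Suc i)) + (f (length as + Suc (length bs)) +
        (\<Sum>i<length cs. f (length as + Suc (length bs + Suc i))))"
      by (rule sum_split_position)
    also have "(\<Sum>i<length bs. f (length as + Suc i)) = 0"
      by (intro sum.neutral) (simp only: f_def o n omit_Suc nth_Cons_Suc, simp add: omit_append_left nth_append 2)
    also have "(\<Sum>i<length cs. f (length as + Suc (length bs + Suc i))) = 0"
      by (intro sum.neutral) (simp only: f_def o n omit_Suc nth_Cons_Suc omit_append_right nth_append_length_plus, simp add: 3)
    also have "f (length as + Suc (length bs)) = (-1) ^ (length as + Suc (length bs)) * dird \<alpha> x v (as @ v # bs @ cs)"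
      unfolding f_def o n omit_Suc nth_Cons_Suc using omit_append_right[of bs 0 "v # cs"] by (simp add: omit_0)
    also have "dird \<alpha> x v (as @ v # bs @ cs) = (-1) ^ length bs * dird \<alpha> x v (as @ bs @ v # cs)"
      by (rule alternating_form_move[OF D[OF R(1)]])
    finally have "(\<Sum>i<length vs. f i) = 0"
      by (simp add: power_add mult.assoc[symmetric] flip: power_mult_distrib)
    then show ?thesis using True x by (simp add: extd_def f_def)
  qed (simp add: extd_def)
qed

lemma pform_extd:
  assumes a: "\<alpha> \<in> pform r l d"
  shows "extd d \<alpha> \<in> pform r (Suc l) d"
proof -
  have "\<exists>p\<in>polynomials r. \<forall>x\<in>Rd d. extd d \<alpha> x vs = p x" for vs
  proof (cases "set vs \<subseteq> Rd d")
    case True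
    have "\<exists>p\<in>polynomials r. \<forall>x\<in>Rd d. dird \<alpha> x (vs ! i) (omit i vs) = p x" if "i < length vs" for i
    proof (rule pform_gradient[OF a, of "omit i vs"])
      fix g :: "'a \<Rightarrow> 'a rvec \<Rightarrow> real"
      assume "\<And>i. g i \<in> polynomials r"
        "\<And>x v. x \<in> Rd d \<Longrightarrow> v \<in> Rd d \<Longrightarrow> dird \<alpha> x v (omit i vs) = (\<Sum>i\<in>UNIV. v $ i * g i x)"
      moreover have "vs ! i \<in> Rd d" using True that by auto
      ultimately show ?thesis
        by (intro bexI[of _ "\<lambda>x. \<Sum>j\<in>UNIV. (vs ! i) $ j * g j x"] polynomials_sum polynomials_scale) auto
    qed
    then obtain P where "\<And>i. i < length vs \<Longrightarrow> P i \<in> polynomials r"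
      "\<And>i x. i < length vs \<Longrightarrow> x \<in> Rd d \<Longrightarrow> dird \<alpha> x (vs ! i) (omit i vs) = P i x" by metis
    then show ?thesis
      using True
      by (intro bexI[of _ "\<lambda>x. \<Sum>i<length vs. (-1) ^ i * P i x"] polynomials_sum polynomials_scale)
        (auto simp: extd_def)
  next
    case False
    then show ?thesis using polynomials_zero by (intro bexI[of _ "\<lambda>_. 0"]) (auto simp: extd_def)
  qed
  then show ?thesis
    using alternating_form_extd[OF a] by (auto simp: pform_def extd_def fun_eq_iff)
qed

lemma alternating_form_contract:
  assumes w: "alternating_form d (Suc l) w" and x: "x \<in> Rd d"
  shows "alternating_form d l (\<lambda>vs. w (x # vs))"
  unfolding alternating_form_def
proof (intro conjI allI impI)
  fix us vs :: "'a rvec list" and y z c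
  assume "set (us @ y # z # vs) \<subseteq> Rd d \<and> length (us @ y # vs) = l"
  then show "w (x # us @ (y + c *\<^sub>R z) # vs) = w (x # us @ y # vs) + c * w (x # us @ z # vs)"
    using alternating_form_linear[OF w, of "x # us" y z vs c] x by simp
qed (use alternating_form_junk[OF w] alternating_form_distinct[OF w] in auto)

lemma pform_contract:
  assumes a: "\<alpha> \<in> pform r (Suc l) d" and b: "b \<in> Rd d"
  shows "(\<lambda>x vs. \<alpha> x (b # vs)) \<in> pform r l d"
  using a alternating_form_contract[OF pform_alternating[OF a] b]
  unfolding pform_def by auto

text \<open>The inserted x is expanded over the basis, and each of its coordinates raises the degree
  by one.\<close>

lemma pform_koszul:
  assumes a: "\<alpha> \<in> pform r (Suc l) d"
  shows "koszul \<alpha> \<in> pform (r + 1) l d"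
proof -
  have "\<exists>p\<in>polynomials (r + 1). \<forall>x\<in>Rd d. \<alpha> x (x # vs) = p x" for vs
  proof (cases "set vs \<subseteq> Rd d \<and> length vs = l")
    case True
    obtain P where P: "\<And>j. P j \<in> polynomials r" "\<And>j x. x \<in> Rd d \<Longrightarrow> \<alpha> x (axis j 1 # vs) = P j x"
      using pform_polynomial[OF a, of "axis _ 1 # vs"] by metis
    have "\<alpha> x (x # vs) = (\<Sum>j\<in>UNIV. x $ j * P j x)" if "x \<in> Rd d" for x
      using alternating_form_expand[OF pform_alternating[OF a that], of "[]" x vs] P that True by simp
    then show ?thesis
      using P by (intro bexI[of _ "\<lambda>x. \<Sum>j\<in>UNIV. x $ j * P j x"] polynomials_sum
          polynomials_mult_coordinate) auto
  next
    case False
    then have "\<alpha> x (x # vs) = 0" for x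
      using pform_junk[OF a, of "x # vs" x] by auto
    then show ?thesis
      using polynomials_zero by (intro bexI[of _ "\<lambda>_. 0"]) auto
  qed
  moreover have "alternating_form d l (koszul \<alpha> x)" if "x \<in> Rd d" for x
    using alternating_form_contract[OF pform_alternating[OF a that] that] by (simp add: koszul_def[abs_def])
  ultimately show ?thesis
    using pform_off[OF a] by (auto simp: pform_def koszul_def fun_eq_iff)
qed

text \<open>Euler's formula: a homogeneous coefficient of degree \<open>r\<close> satisfies \<open>D\<^sub>x \<alpha> = r \<alpha>\<close>.\<close>

lemma pform_euler:
  assumes a: "\<alpha> \<in> pform r l d"
  shows "(\<lambda>x vs. if x \<in> Rd d then dird \<alpha> x x vs - of_int r * \<alpha> x vs else 0) \<in> pform (r - 1) l d"
proof -
  have "\<exists>p\<in>polynomials (r - 1). \<forall>x\<in>Rd d. dird \<alpha> x x vs - of_int r * \<alpha> x vs = p x" for vs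
  proof (rule pform_gradient[OF a, of vs])
    fix p and g :: "'a \<Rightarrow> 'a rvec \<Rightarrow> real"
    assume "\<And>x. x \<in> Rd d \<Longrightarrow> \<alpha> x vs = p x"
      "\<And>x v. x \<in> Rd d \<Longrightarrow> v \<in> Rd d \<Longrightarrow> dird \<alpha> x v vs = (\<Sum>i\<in>UNIV. v $ i * g i x)"
      "(\<lambda>x. (\<Sum>i\<in>UNIV. x $ i * g i x) - of_int r * p x) \<in> polynomials (r - 1)"
    then show ?thesis
      by (intro bexI[of _ "\<lambda>x. (\<Sum>i\<in>UNIV. x $ i * g i x) - of_int r * p x"]) auto
  qed
  moreover have "alternating_form d l (\<lambda>vs. dird \<alpha> x x vs - of_int r * \<alpha> x vs)" if "x \<in> Rd d" for x
    using alternating_form_add[OF alternating_form_dird[OF a that that] pform_alternating[OF a that],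
        of 1 "- of_int r"] by simp
  ultimately show ?thesis by (auto simp: pform_def)
qed

text \<open>Cartan's formula for the radial field. By the product rule, differentiating
  \<open>koszul\<close> along v_i gives a term from the inserted point and one from the
  coefficients. Moving v_i back to position i absorbs the sign of the first, which yields
  \<open>Suc l\<close> copies of \<alpha>. The second terms cancel against the exterior derivative
  with x inserted in front, whose leading term is the derivative along x.\<close>

lemma homotopy_formula:
  assumes a: "\<alpha> \<in> pform r (Suc l) d" and x: "x \<in> Rd d"
    and vs: "set vs \<subseteq> Rd d" "length vs = Suc l"
  shows "extd d (koszul \<alpha>) x vs + koszul (extd d \<alpha>) x vs = of_nat (Suc l) * \<alpha> x vs + dird \<alpha> x x vs"
proof -
  have 1: "dird (koszul \<alpha>) x (vs ! i) (omit i vs)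
      = \<alpha> x (vs ! i # omit i vs) + dird \<alpha> x (vs ! i) (x # omit i vs)" if "i < length vs" for i
  proof -
    let ?v = "vs ! i" and ?ws = "omit i vs"
    have v: "?v \<in> Rd d" and ws: "set ?ws \<subseteq> Rd d" "length ?ws = l"
      using that vs set_omit[of i vs] by (auto simp: length_omit)
    have "koszul \<alpha> (x + t *\<^sub>R ?v) ?ws = \<alpha> (x + t *\<^sub>R ?v) (x # ?ws) + t * \<alpha> (x + t *\<^sub>R ?v) (?v # ?ws)" for t
      unfolding koszul_def
      using alternating_form_linear[OF pform_alternating[OF a], of "x + t *\<^sub>R ?v" "[]" x ?v ?ws t] x v ws
      by (simp add: Rd_add Rd_scale)
    then have "((\<lambda>t. koszul \<alpha> (x + t *\<^sub>R ?v) ?ws) has_real_derivative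
        \<alpha> x (?v # ?ws) + dird \<alpha> x ?v (x # ?ws)) (at 0)"
      by (auto intro!: derivative_eq_intros pform_has_real_derivative[OF a x v])
    then show ?thesis unfolding dird_def[of "koszul \<alpha>"] by (rule DERIV_imp_deriv)
  qed
  have 2: "(-1) ^ i * \<alpha> x (vs ! i # omit i vs) = \<alpha> x vs" if "i < length vs" for i
    using alternating_form_move[OF pform_alternating[OF a x], of "[]" "vs ! i" "take i vs" "drop (Suc i) vs"] that
    by (simp add: omit_def id_take_nth_drop[symmetric] mult.assoc[symmetric] flip: power_mult_distrib)
  have "extd d (koszul \<alpha>) x vs
      = (\<Sum>i<length vs. (-1) ^ i * \<alpha> x (vs ! i # omit i vs) + (-1) ^ i * dird \<alpha> x (vs ! i) (x # omit i vs))"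
    using x vs by (simp add: extd_def 1 distrib_left)
  also have "\<dots> = (\<Sum>i<length vs. \<alpha> x vs + (-1) ^ i * dird \<alpha> x (vs ! i) (x # omit i vs))"
    using 2 by (intro sum.cong) auto
  also have "\<dots> = of_nat (Suc l) * \<alpha> x vs + (\<Sum>i<length vs. (-1) ^ i * dird \<alpha> x (vs ! i) (x # omit i vs))"
    using vs by (simp add: sum.distrib del: of_nat_Suc)
  finally have "extd d (koszul \<alpha>) x vs = of_nat (Suc l) * \<alpha> x vs
      + (\<Sum>i<length vs. (-1) ^ i * dird \<alpha> x (vs ! i) (x # omit i vs))" .
  moreover have "koszul (extd d \<alpha>) x vs
      = dird \<alpha> x x vs - (\<Sum>i<length vs. (-1) ^ i * dird \<alpha> x (vs ! i) (x # omit i vs))"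
    using x vs
    by (simp add: koszul_def extd_def sum.lessThan_Suc_shift omit_0 omit_Suc sum_negf
        del: sum.lessThan_Suc)
  ultimately show ?thesis by simp
qed

text \<open>The shift to degree \<open>int k - 1\<close> makes the zero form the base case. For
  degree k, the homotopy formula reads (k + l + 1) \<gamma> + \<gamma>' with \<gamma>' of lower
  degree by Euler's formula; the induction hypothesis decomposes \<gamma>', and one divides by k + l
  + 1.\<close>

lemma pform_koszul_decomposition:
  assumes "\<gamma> \<in> pform (int k - 1) (Suc l) d"
  shows "\<exists>\<xi>\<in>pform (int k) l d. \<exists>\<zeta>\<in>pform (int k - 1) (Suc (Suc l)) d. \<forall>x\<in>Rd d. \<forall>vs.
    set vs \<subseteq> Rd d \<longrightarrow> length vs = Suc l \<longrightarrow> \<gamma> x vs = extd d \<xi> x vs + koszul \<zeta> x vs"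
  using assms
proof (induction k arbitrary: \<gamma>)
  case 0
  have "extd d (\<lambda>_ _. 0) x vs = 0" for x :: "'a rvec" and vs by (simp add: extd_def dird_def)
  then show ?case
    using pform_negative[OF 0] by (intro bexI[OF _ pform_zero]) (simp add: koszul_def)
next
  case (Suc k)
  then have g: "\<gamma> \<in> pform (int k) (Suc l) d" by simp
  define \<gamma>' where "\<gamma>' = (\<lambda>x vs. if x \<in> Rd d then dird \<gamma> x x vs - of_int (int k) * \<gamma> x vs else 0)"
  have "\<gamma>' \<in> pform (int k - 1) (Suc l) d"
    unfolding \<gamma>'_def by (rule pform_euler[OF g])
  then obtain \<xi> \<zeta> where \<xi>: "\<xi> \<in> pform (int k) l d" and \<zeta>: "\<zeta> \<in> pform (int k - 1) (Suc (Suc l)) d"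
    and eq: "\<And>x vs. x \<in> Rd d \<Longrightarrow> set vs \<subseteq> Rd d \<Longrightarrow> length vs = Suc l \<Longrightarrow>
      \<gamma>' x vs = extd d \<xi> x vs + koszul \<zeta> x vs"
    using Suc.IH by blast
  \<comment> \<open>Inverse of the factor by which d kappa + kappa d acts on the part of \<gamma>
    homogeneous of degree k: k from Euler's formula, \<open>Suc l\<close> from the form
    degree.\<close>
  define c where "c = 1 / (real k + real (Suc l))"
  have c: "c * (real k + real (Suc l)) = 1" unfolding c_def by simp
  define \<xi>' where "\<xi>' = (\<lambda>x vs. c * koszul \<gamma> x vs + (- c) * \<xi> x vs)"
  define \<zeta>' where "\<zeta>' = (\<lambda>x vs. c * extd d \<gamma> x vs + (- c) * \<zeta> x vs)"
  have kg: "koszul \<gamma> \<in> pform (int (Suc k)) l d" using pform_koszul[OF g] by (simp add: add.commute)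
  have xi: "\<xi> \<in> pform (int (Suc k)) l d" using \<xi> by (rule pform_mono) simp
  have ze: "\<zeta> \<in> pform (int k) (Suc (Suc l)) d" using \<zeta> by (rule pform_mono) simp
  have "\<xi>' \<in> pform (int (Suc k)) l d" unfolding \<xi>'_def by (rule pform_combine[OF kg xi])
  moreover have "\<zeta>' \<in> pform (int (Suc k) - 1) (Suc (Suc l)) d"
    unfolding \<zeta>'_def using pform_combine[OF pform_extd[OF g] ze, of c "- c"] by simp
  moreover have "\<gamma> x vs = extd d \<xi>' x vs + koszul \<zeta>' x vs"
    if "x \<in> Rd d" "set vs \<subseteq> Rd d" "length vs = Suc l" for x vs
  proof -
    have "extd d \<xi>' x vs + koszul \<zeta>' x vs = c * (extd d (koszul \<gamma>) x vs + koszul (extd d \<gamma>) x vs)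
        - c * (extd d \<xi> x vs + koszul \<zeta> x vs)"
      unfolding \<xi>'_def extd_combine[OF kg xi] by (simp add: \<zeta>'_def koszul_def algebra_simps)
    also have "\<dots> = c * (of_nat (Suc l) * \<gamma> x vs + dird \<gamma> x x vs) - c * \<gamma>' x vs"
      using homotopy_formula[OF g that] eq[OF that] by simp
    also have "\<dots> = c * (real k + real (Suc l)) * \<gamma> x vs"
      using that by (simp add: \<gamma>'_def algebra_simps)
    finally show ?thesis by (simp only: c)
  qed
  ultimately show ?case by blast
qed

section \<open>Pullback by affine maps\<close>

definition affine_pull :: "nat \<Rightarrow> ('n::{finite,linorder} rvec \<Rightarrow> 'n rvec) \<Rightarrow> 'n rvec \<Rightarrow>
    ('n rvec \<Rightarrow> 'n rvec list \<Rightarrow> real) \<Rightarrow> 'n rvec \<Rightarrow> 'n rvec list \<Rightarrow> real" where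
  "affine_pull d L b \<alpha> x vs = (if x \<in> Rd d \<and> set vs \<subseteq> Rd d then \<alpha> (L x + b) (map L vs) else 0)"

lemma pform_affine_pull:
  fixes L :: "'n::{finite,linorder} rvec \<Rightarrow> 'n rvec"
  assumes L: "linear L" "\<And>x. x \<in> Rd e \<Longrightarrow> L x \<in> Rd d" and b: "b \<in> Rd d"
    and a: "\<alpha> \<in> pform r l d"
  shows "affine_pull e L b \<alpha> \<in> pform r l e"
proof -
  have "alternating_form e l (affine_pull e L b \<alpha> x)" if x: "x \<in> Rd e" for x
  proof -
    have Tx: "L x + b \<in> Rd d" using L b x by (simp add: Rd_add)
    note alt = pform_alternating[OF a Tx]
    show ?thesis
      unfolding alternating_form_def
    proof (intro conjI allI impI)
      fix us vs :: "'n rvec list" and y z c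
      assume *: "set (us @ y # z # vs) \<subseteq> Rd e \<and> length (us @ y # vs) = l"
      then have "y + c *\<^sub>R z \<in> Rd e" by (simp add: Rd_add Rd_scale)
      moreover have "set (map L us @ L y # L z # map L vs) \<subseteq> Rd d" using * L by auto
      ultimately show "affine_pull e L b \<alpha> x (us @ (y + c *\<^sub>R z) # vs)
          = affine_pull e L b \<alpha> x (us @ y # vs) + c * affine_pull e L b \<alpha> x (us @ z # vs)"
        using * x alternating_form_linear[OF alt, of "map L us" "L y" "L z" "map L vs" c]
        by (simp add: affine_pull_def linear_add[OF L(1)] linear_scale[OF L(1)])
    qed (use alternating_form_junk[OF alt] alternating_form_distinct[OF alt]
        in \<open>auto simp: affine_pull_def distinct_map\<close>)
  qed
  moreover have "\<exists>p\<in>polynomials r. \<forall>x\<in>Rd e. affine_pull e L b \<alpha> x vs = p x" for vs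
  proof (cases "set vs \<subseteq> Rd e")
    case True
    obtain p where "p \<in> polynomials r" "\<And>y. y \<in> Rd d \<Longrightarrow> \<alpha> y (map L vs) = p y"
      using pform_polynomial[OF a] by blast
    then show ?thesis
      using True L b polynomials_compose_affine[OF L(1), of p r b]
      by (intro bexI[of _ "\<lambda>x. p (L x + b)"]) (auto simp: affine_pull_def Rd_add)
  next
    case False
    then show ?thesis
      using polynomials_zero by (intro bexI[of _ "\<lambda>_. 0"]) (auto simp: affine_pull_def)
  qed
  ultimately show ?thesis by (auto simp: pform_def affine_pull_def fun_eq_iff)
qed

text \<open>An affine map sends the line x + t v to the line T x + t L v with the same parameter, so
  both sides differentiate one and the same function of t.\<close>

lemma extd_affine_pull:
  assumes L: "linear L" "\<And>x. x \<in> Rd e \<Longrightarrow> L x \<in> Rd d" and b: "b \<in> Rd d"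
    and x: "x \<in> Rd e" and vs: "set vs \<subseteq> Rd e"
  shows "extd e (affine_pull e L b \<alpha>) x vs = extd d \<alpha> (L x + b) (map L vs)"
proof -
  have "dird (affine_pull e L b \<alpha>) x (vs ! i) (omit i vs)
      = dird \<alpha> (L x + b) (L (vs ! i)) (omit i (map L vs))" if i: "i < length vs" for i
  proof (rule dird_cong)
    fix t
    have "vs ! i \<in> Rd e" "set (omit i vs) \<subseteq> Rd e" using vs set_omit[of i vs] i by auto
    then show "affine_pull e L b \<alpha> (x + t *\<^sub>R vs ! i) (omit i vs)
        = \<alpha> (L x + b + t *\<^sub>R L (vs ! i)) (omit i (map L vs))"
      using x by (simp add: affine_pull_def Rd_add Rd_scale linear_add[OF L(1)] linear_scale[OF L(1)]
          omit_def take_map drop_map ac_simps)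
  qed
  moreover have "L x + b \<in> Rd d" "L ` set vs \<subseteq> Rd d" using L b x vs by (auto simp: Rd_add)
  ultimately show ?thesis using x vs by (simp add: extd_def)
qed

text \<open>Off the domain all three terms take the default value 0, so the identity holds without
  side conditions and can be used for rewriting.\<close>

lemma pform_koszul_decomposition':
  assumes g: "\<gamma> \<in> pform (int k - 1) (Suc l) d"
  obtains \<xi> \<zeta> where "\<xi> \<in> pform (int k) l d" "\<zeta> \<in> pform (int k - 1) (Suc (Suc l)) d"
    "\<And>x vs. \<gamma> x vs = extd d \<xi> x vs + koszul \<zeta> x vs"
proof -
  obtain \<xi> \<zeta> where \<xi>: "\<xi> \<in> pform (int k) l d" and \<zeta>: "\<zeta> \<in> pform (int k - 1) (Suc (Suc l)) d"
    and eq: "\<And>x vs. x \<in> Rd d \<Longrightarrow> set vs \<subseteq> Rd d \<Longrightarrow> length vs = Suc l \<Longrightarrow>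
      \<gamma> x vs = extd d \<xi> x vs + koszul \<zeta> x vs"
    using pform_koszul_decomposition[OF g] by blast
  have "\<gamma> x vs = extd d \<xi> x vs + koszul \<zeta> x vs" for x vs
    using eq[of x vs] pform_off[OF g] pform_off[OF pform_extd[OF \<xi>]] pform_off[OF pform_koszul[OF \<zeta>]]
      pform_junk[OF g] pform_junk[OF pform_extd[OF \<xi>]] pform_junk[OF pform_koszul[OF \<zeta>]]
    by (metis add_0)
  then show thesis using that \<xi> \<zeta> by blast
qed

text \<open>
  An affine map turns the identity vector field into itself plus a constant field; the
  contribution of the latter has degree at most \<open>r - 1\<close> and is trimmed by the homotopy formula.
\<close>

lemma affine_pull_trimmed:
  fixes L :: "'n::{finite,linorder} rvec \<Rightarrow> 'n rvec"
  assumes L: "linear L" "\<And>x. x \<in> Rd e \<Longrightarrow> L x \<in> Rd d" and b: "b \<in> Rd d"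
    and \<alpha>: "\<alpha> \<in> pform (int k) l d" and \<beta>: "\<beta> \<in> pform (int k - 1) (Suc (Suc l)) d"
  obtains \<alpha>' \<beta>' where "\<alpha>' \<in> pform (int k) l e" "\<beta>' \<in> pform (int k - 1) (Suc (Suc l)) e"
    "\<And>x vs. x \<in> Rd e \<Longrightarrow> set vs \<subseteq> Rd e \<Longrightarrow>
      extd d \<alpha> (L x + b) (map L vs) + koszul \<beta> (L x + b) (map L vs)
        = extd e \<alpha>' x vs + koszul \<beta>' x vs"
proof -
  define \<gamma> where "\<gamma> = affine_pull e L b (\<lambda>x vs. \<beta> x (b # vs))"
  have pull: "\<omega> \<in> pform r m d \<Longrightarrow> affine_pull e L b \<omega> \<in> pform r m e" for \<omega> r m
    by (rule pform_affine_pull[OF L b])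
  have "\<gamma> \<in> pform (int k - 1) (Suc l) e"
    unfolding \<gamma>_def by (intro pull pform_contract[OF \<beta> b])
  then obtain \<xi> \<zeta> where \<xi>: "\<xi> \<in> pform (int k) l e" and \<zeta>: "\<zeta> \<in> pform (int k - 1) (Suc (Suc l)) e"
    and \<gamma>: "\<And>x vs. \<gamma> x vs = extd e \<xi> x vs + koszul \<zeta> x vs"
    by (rule pform_koszul_decomposition') blast
  \<comment> \<open>The factors 1 give the sums the shape that \<open>pform_combine\<close> and
    \<open>extd_combine\<close> expect.\<close>
  define \<alpha>' where "\<alpha>' = (\<lambda>x vs. 1 * affine_pull e L b \<alpha> x vs + 1 * \<xi> x vs)"
  define \<beta>' where "\<beta>' = (\<lambda>x vs. 1 * affine_pull e L b \<beta> x vs + 1 * \<zeta> x vs)"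
  have "\<alpha>' \<in> pform (int k) l e" "\<beta>' \<in> pform (int k - 1) (Suc (Suc l)) e"
    unfolding \<alpha>'_def \<beta>'_def
    by (rule pform_combine[OF pull[OF \<alpha>] \<xi>], rule pform_combine[OF pull[OF \<beta>] \<zeta>])
  moreover have "extd d \<alpha> (L x + b) (map L vs) + koszul \<beta> (L x + b) (map L vs)
      = extd e \<alpha>' x vs + koszul \<beta>' x vs" if x: "x \<in> Rd e" and vs: "set vs \<subseteq> Rd e" for x vs
  proof -
    let ?T = "L x + b" and ?vs = "map L vs"
    have T: "?T \<in> Rd d" "L x \<in> Rd d" "set ?vs \<subseteq> Rd d" using L b x vs by (auto simp: Rd_add)
    have "koszul \<beta> ?T ?vs = \<beta> ?T (L x # ?vs) + \<beta> ?T (b # ?vs)"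
    proof (cases "length vs = Suc l")
      case True
      then show ?thesis
        using alternating_form_linear[OF pform_alternating[OF \<beta> T(1)], of "[]" "L x" b ?vs 1] T b
        by (simp add: koszul_def)
    next
      case False
      then show ?thesis using pform_junk[OF \<beta>] by (simp add: koszul_def)
    qed
    also have "\<beta> ?T (b # ?vs) = \<gamma> x vs"
      using x vs by (simp add: \<gamma>_def affine_pull_def)
    also have "\<beta> ?T (L x # ?vs) = koszul (affine_pull e L b \<beta>) x vs"
      using x vs by (simp add: koszul_def affine_pull_def)
    finally have 1: "koszul \<beta> ?T ?vs = koszul (affine_pull e L b \<beta>) x vs + (extd e \<xi> x vs + koszul \<zeta> x vs)"
      by (simp only: \<gamma>)
    have 2: "extd d \<alpha> ?T ?vs = extd e (affine_pull e L b \<alpha>) x vs"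
      by (rule extd_affine_pull[OF L b x vs, symmetric])
    show ?thesis
      unfolding 1 2 \<alpha>'_def extd_combine[OF pull[OF \<alpha>] \<xi>] by (simp add: \<beta>'_def koszul_def)
  qed
  ultimately show thesis using that by blast
qed

section \<open>Derivatives of local extensions\<close>

lemma interior_Rd_iff:
  "y \<in> interior_Rd d S \<longleftrightarrow> y \<in> Rd d \<and> (\<exists>e>0. \<forall>z\<in>Rd d. dist z y < e \<longrightarrow> z \<in> S)"
proof
  assume "y \<in> interior_Rd d S"
  then obtain T where "open T" "y \<in> T" "y \<in> Rd d" "Rd d \<inter> T \<subseteq> S"
    unfolding interior_Rd_def interior_of_def by (auto simp: openin_open)
  moreover obtain e where "e > 0" "\<And>z. dist z y < e \<Longrightarrow> z \<in> T"
    using \<open>open T\<close> \<open>y \<in> T\<close> by (meson open_dist)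
  ultimately show "y \<in> Rd d \<and> (\<exists>e>0. \<forall>z\<in>Rd d. dist z y < e \<longrightarrow> z \<in> S)"
    by blast
next
  assume "y \<in> Rd d \<and> (\<exists>e>0. \<forall>z\<in>Rd d. dist z y < e \<longrightarrow> z \<in> S)"
  then obtain e where "y \<in> Rd d" "e > 0" "\<And>z. z \<in> Rd d \<Longrightarrow> dist z y < e \<Longrightarrow> z \<in> S" by blast
  then show "y \<in> interior_Rd d S"
    unfolding interior_Rd_def interior_of_def
    by (intro CollectI exI[of _ "Rd d \<inter> ball y e"])
      (auto simp: openin_open_Int dist_commute)
qed

lemma interior_Rd_subset: "interior_Rd d S \<subseteq> S" "interior_Rd d S \<subseteq> Rd d"
  by (auto simp: interior_Rd_iff)

lemma openin_interior_Rd: "openin (top_of_set (Rd d)) (interior_Rd d S)"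
  by (simp add: interior_Rd_def)

text \<open>Localizes the condition under which \<open>deriv_on\<close> is well determined from U_f
  to the part of U_f lying over a chart.\<close>

lemma closure_interior_Rd_Int_open:
  assumes "x \<in> closure (interior_Rd d U)" "open W" "x \<in> W"
  shows "x \<in> closure (interior_Rd d (U \<inter> W))"
proof -
  have "W \<inter> interior_Rd d U \<subseteq> interior_Rd d (U \<inter> W)"
  proof
    fix y assume "y \<in> W \<inter> interior_Rd d U"
    then have y: "y \<in> W" "y \<in> interior_Rd d U" by auto
    obtain e1 where "e1 > 0" "\<And>z. dist z y < e1 \<Longrightarrow> z \<in> W"
      using \<open>open W\<close> y by (meson open_dist)
    moreover obtain e2 where "e2 > 0" "\<And>z. z \<in> Rd d \<Longrightarrow> dist z y < e2 \<Longrightarrow> z \<in> U"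
      using y unfolding interior_Rd_iff by blast
    ultimately show "y \<in> interior_Rd d (U \<inter> W)"
      using y unfolding interior_Rd_iff by (auto intro!: exI[of _ "min e1 e2"])
  qed
  then have "closure (W \<inter> interior_Rd d U) \<subseteq> closure (interior_Rd d (U \<inter> W))"
    by (rule closure_mono)
  moreover have "x \<in> closure (W \<inter> interior_Rd d U)"
    using open_Int_closure_subset[OF assms(2), of "interior_Rd d U"] assms by auto
  ultimately show ?thesis by blast
qed

lemma C1_open_open: "C1_open S G \<Longrightarrow> open S"
  by (simp add: C1_open_def)

lemma C1_open_has_derivative:
  "C1_open S G \<Longrightarrow> x \<in> S \<Longrightarrow> (G has_derivative frechet_derivative G (at x)) (at x)"
  unfolding C1_open_def by (metis differentiableI frechet_derivative_works)

lemma C1_open_continuous_on: "C1_open S G \<Longrightarrow> continuous_on S G"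
  by (meson C1_open_has_derivative continuous_at_imp_continuous_on has_derivative_continuous)

lemma C2_open_imp_C1_open: "C2_open S G \<Longrightarrow> C1_open S G"
  unfolding C2_open_def C1_open_def[of S G] using C1_open_continuous_on by blast

lemma C1_open_subset: "C1_open S G \<Longrightarrow> open T \<Longrightarrow> T \<subseteq> S \<Longrightarrow> C1_open T G"
  unfolding C1_open_def by (auto intro: continuous_on_subset)

lemma C1_open_diff:
  assumes "C1_open S G" "C1_open S H"
  shows "C1_open S (\<lambda>x. G x - H x)"
proof -
  obtain G' H' where "\<forall>x\<in>S. (G has_derivative blinfun_apply (G' x)) (at x)" "continuous_on S G'"
    "\<forall>x\<in>S. (H has_derivative blinfun_apply (H' x)) (at x)" "continuous_on S H'"
    using assms unfolding C1_open_def by blast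
  then show ?thesis
    using assms unfolding C1_open_def
    by (intro conjI exI[of _ "\<lambda>x. G' x - H' x"])
      (auto simp: blinfun.diff_left[abs_def] intro!: continuous_intros has_derivative_diff)
qed

lemma C1_open_compose:
  assumes G: "C1_open S G" and H: "C1_open T H"
  shows "C1_open (S \<inter> G -` T) (\<lambda>x. H (G x))"
proof -
  obtain G' where G': "\<And>x. x \<in> S \<Longrightarrow> (G has_derivative blinfun_apply (G' x)) (at x)" "continuous_on S G'"
    using G unfolding C1_open_def by blast
  obtain H' where H': "\<And>x. x \<in> T \<Longrightarrow> (H has_derivative blinfun_apply (H' x)) (at x)" "continuous_on T H'"
    using H unfolding C1_open_def by blast
  have "open (S \<inter> G -` T)"
    by (rule continuous_open_preimage[OF C1_open_continuous_on[OF G] C1_open_open[OF G] C1_open_open[OF H]])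
  moreover have "continuous_on (S \<inter> G -` T) (\<lambda>x. H' (G x) o\<^sub>L G' x)"
  proof (intro bounded_bilinear.continuous_on[OF bounded_bilinear_blinfun_compose])
    show "continuous_on (S \<inter> G -` T) (\<lambda>x. H' (G x))"
      by (rule continuous_on_compose2[OF H'(2)])
        (auto intro: continuous_on_subset[OF C1_open_continuous_on[OF G]])
    show "continuous_on (S \<inter> G -` T) G'" by (rule continuous_on_subset[OF G'(2)]) auto
  qed
  moreover have "((\<lambda>x. H (G x)) has_derivative blinfun_apply (H' (G x) o\<^sub>L G' x)) (at x)"
    if "x \<in> S \<inter> G -` T" for x
    using has_derivative_compose[OF G'(1) H'(1)] that by (auto simp: o_def blinfun_compose.rep_eq)
  ultimately show ?thesis
    unfolding C1_open_def by (intro conjI exI[of _ "\<lambda>x. H' (G x) o\<^sub>L G' x"] ballI)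
qed

lemma C1_open_affine:
  fixes L :: "'e::euclidean_space \<Rightarrow> 'f::euclidean_space"
  assumes "linear L"
  shows "C1_open UNIV (\<lambda>x. L x + b)"
proof -
  have "bounded_linear L" using assms by (simp add: linear_conv_bounded_linear)
  then show ?thesis
    unfolding C1_open_def
    by (intro conjI exI[of _ "\<lambda>_. Blinfun L"])
      (auto simp: bounded_linear_Blinfun_apply intro!: derivative_eq_intros bounded_linear_imp_has_derivative)
qed

text \<open>At a relative interior point a short line in direction w stays in the zero set, so the
  derivative along w is 0 there. Continuity of the derivative carries this to limit points, and this
  is where C^1 extensions matter.\<close>

lemma C1_vanishing_derivative:
  fixes K :: "'n::{finite,linorder} rvec \<Rightarrow> 'b::real_normed_vector"
  assumes K: "C1_open M K" and z: "\<And>y. y \<in> M \<inter> S \<Longrightarrow> K y = 0"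
    and x: "x \<in> M" "x \<in> closure (interior_Rd d S)" and w: "w \<in> Rd d"
  shows "frechet_derivative K (at x) w = 0"
proof -
  obtain K' where K': "\<And>x. x \<in> M \<Longrightarrow> (K has_derivative blinfun_apply (K' x)) (at x)" "continuous_on M K'"
    using K unfolding C1_open_def by blast
  have M: "open M" using K by (rule C1_open_open)
  have 0: "K' y w = 0" if y: "y \<in> M" "y \<in> interior_Rd d S" for y
  proof -
    obtain e1 where e1: "e1 > 0" "\<And>z. dist z y < e1 \<Longrightarrow> z \<in> M"
      using M y by (meson open_dist)
    obtain e2 where e2: "e2 > 0" "\<And>z. z \<in> Rd d \<Longrightarrow> dist z y < e2 \<Longrightarrow> z \<in> S"
      using y unfolding interior_Rd_iff by blast
    have "((\<lambda>t::real. K (y + t *\<^sub>R w)) has_derivative (\<lambda>t. K' y (t *\<^sub>R w))) (at 0)"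
      by (rule has_derivative_compose[of "\<lambda>t. y + t *\<^sub>R w" "\<lambda>t. t *\<^sub>R w"])
        (use K'(1)[OF y(1)] in \<open>auto intro!: derivative_eq_intros\<close>)
    moreover have "((\<lambda>t::real. K (y + t *\<^sub>R w)) has_derivative (\<lambda>_. 0)) (at 0)"
    proof (rule has_derivative_transform_eventually[OF has_derivative_const])
      have "((\<lambda>t::real. y + t *\<^sub>R w) \<longlongrightarrow> y + 0 *\<^sub>R w) (at 0)" by (intro tendsto_intros)
      then have "((\<lambda>t::real. y + t *\<^sub>R w) \<longlongrightarrow> y) (at 0)" by simp
      then have "eventually (\<lambda>t::real. dist (y + t *\<^sub>R w) y < min e1 e2) (at 0)"
        using e1(1) e2(1) by (intro tendstoD) auto
      then show "eventually (\<lambda>t::real. 0 = K (y + t *\<^sub>R w)) (at 0)"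
      proof eventually_elim
        case (elim t)
        have "y + t *\<^sub>R w \<in> Rd d" using y w interior_Rd_subset(2) by (auto intro!: Rd_add Rd_scale)
        then show ?case using elim e1 e2 z by simp
      qed
      show "0 = K (y + 0 *\<^sub>R w)" using y z interior_Rd_subset(1) by auto
    qed simp
    ultimately have "(\<lambda>t::real. K' y (t *\<^sub>R w)) = (\<lambda>_. 0)" by (rule has_derivative_unique)
    from fun_cong[OF this, of 1] show ?thesis by simp
  qed
  obtain s where s: "\<And>n. s n \<in> interior_Rd d S" "s \<longlonglongrightarrow> x"
    using x(2) unfolding closure_sequential by blast
  have "isCont K' x" using K'(2) M x(1) by (simp add: continuous_on_eq_continuous_at)
  then have "(\<lambda>n. K' (s n)) \<longlonglongrightarrow> K' x" using s(2) by (rule isCont_tendsto_compose)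
  then have "(\<lambda>n. K' (s n) w) \<longlonglongrightarrow> K' x w" by (intro tendsto_intros)
  moreover have "eventually (\<lambda>n. K' (s n) w = 0) sequentially"
    using topological_tendstoD[OF s(2) M x(1)] by eventually_elim (use 0 s(1) in auto)
  then have "(\<lambda>n. K' (s n) w) \<longlonglongrightarrow> 0" by (rule tendsto_eventually)
  ultimately have "K' x w = 0" by (rule LIMSEQ_unique)
  then show ?thesis using frechet_derivative_at[OF K'(1)[OF x(1)]] by simp
qed

lemma C1_agree_derivative:
  fixes G :: "'n::{finite,linorder} rvec \<Rightarrow> 'b::real_normed_vector"
  assumes G: "C1_open M G" and H: "C1_open N H" and eq: "\<And>y. y \<in> M \<inter> N \<inter> S \<Longrightarrow> G y = H y"
    and x: "x \<in> M" "x \<in> N" "x \<in> closure (interior_Rd d S)" and w: "w \<in> Rd d"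
  shows "frechet_derivative G (at x) w = frechet_derivative H (at x) w"
proof -
  have o: "open (M \<inter> N)" using G H by (simp add: C1_open_open open_Int)
  have K: "C1_open (M \<inter> N) (\<lambda>x. G x - H x)"
    by (intro C1_open_diff C1_open_subset[OF G o] C1_open_subset[OF H o]) auto
  have "frechet_derivative (\<lambda>x. G x - H x) (at x) w = 0"
    by (rule C1_vanishing_derivative[OF K, of S]) (use eq x w in auto)
  moreover have "((\<lambda>x. G x - H x) has_derivative
      (\<lambda>v. frechet_derivative G (at x) v - frechet_derivative H (at x) v)) (at x)"
    by (intro has_derivative_diff C1_open_has_derivative[OF G] C1_open_has_derivative[OF H] x)
  ultimately show ?thesis by (simp add: frechet_derivative_at[symmetric])
qed

text \<open>Uniqueness turns the definite description in \<open>deriv_on\<close> into the derivative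
  of any single local extension at hand.\<close>

lemma deriv_on_eq:
  fixes G :: "'n::{finite,linorder} rvec \<Rightarrow> 'b::real_normed_vector"
  assumes G: "C1_open N G" "\<And>y. y \<in> N \<inter> S \<Longrightarrow> G y = F y"
    and x: "x \<in> N" "x \<in> closure (interior_Rd d S)" and w: "w \<in> Rd d"
  shows "deriv_on S F x w = frechet_derivative G (at x) w"
  unfolding deriv_on_def
proof (rule the_equality)
  show "\<exists>N' G'. x \<in> N' \<and> C1_open N' G' \<and> (\<forall>y\<in>N' \<inter> S. G' y = F y) \<and>
      frechet_derivative G (at x) w = frechet_derivative G' (at x) w"
    using G x by blast
next
  fix z
  assume "\<exists>N' G'. x \<in> N' \<and> C1_open N' G' \<and> (\<forall>y\<in>N' \<inter> S. G' y = F y) \<and> z = frechet_derivative G' (at x) w"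
  then obtain N' G' where G': "x \<in> N'" "C1_open N' G'" "\<forall>y\<in>N' \<inter> S. G' y = F y"
    "z = frechet_derivative G' (at x) w" by blast
  show "z = frechet_derivative G (at x) w"
    unfolding G'(4) by (rule C1_agree_derivative[OF G'(2) G(1), of S]) (use G G' x w in auto)
qed

section \<open>Coordinates on the cells\<close>

locale affine_mesh =
  fixes X :: "('a::t2_space, 'n::{finite,linorder}) meshed_manifold"
  assumes compact_space: "compact (UNIV :: 'a set)"
    and atlas: "is_atlas (atlas X)"
    and mesh: "is_mesh X"
    and coordinates: "affine_compatible_coordinates X"
begin

lemma chart_at: obtains V \<phi> where "(V, \<phi>) \<in> atlas X" "p \<in> V"
proof -
  have "p \<in> (\<Union>c\<in>atlas X. fst c)" using atlas by (simp add: is_atlas_def)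
  then obtain c where "c \<in> atlas X" "p \<in> fst c" by blast
  then show thesis using that[of "fst c" "snd c"] by simp
qed

lemma open_chart: "(V, \<phi>) \<in> atlas X \<Longrightarrow> open V"
  using atlas by (force simp: is_atlas_def is_chart_def)

lemma inv_chart: "(V, \<phi>) \<in> atlas X \<Longrightarrow> q \<in> V \<Longrightarrow> inv_into V \<phi> (\<phi> q) = q"
  using atlas by (force simp: is_atlas_def is_chart_def homeomorphism_def)

lemma pdom_subset: "f \<in> cells X \<Longrightarrow> pdom X f \<subseteq> Rd (cdim X f)"
  using coordinates by (simp add: affine_compatible_coordinates_def C2_coordinates_def)

lemma homeo: "f \<in> cells X \<Longrightarrow> homeomorphism (pdom X f) (closure f) (param X f) (coord X f)"
  using coordinates by (simp add: affine_compatible_coordinates_def C2_coordinates_def)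

lemma param_interior: "f \<in> cells X \<Longrightarrow> param X f ` interior_Rd (cdim X f) (pdom X f) = f"
  using coordinates by (simp add: affine_compatible_coordinates_def C2_coordinates_def)

lemma C2_param: "f \<in> cells X \<Longrightarrow> (V, \<phi>) \<in> atlas X \<Longrightarrow>
    C2_on {x \<in> pdom X f. param X f x \<in> V} (\<phi> \<circ> param X f)"
  using coordinates by (auto simp: affine_compatible_coordinates_def C2_coordinates_def)

lemma C2_coord: "f \<in> cells X \<Longrightarrow> (V, \<phi>) \<in> atlas X \<Longrightarrow>
    C2_on (\<phi> ` (V \<inter> closure f)) (coord X f \<circ> inv_into V \<phi>)"
  using coordinates by (auto simp: affine_compatible_coordinates_def C2_coordinates_def)

lemma coord_param: "f \<in> cells X \<Longrightarrow> x \<in> pdom X f \<Longrightarrow> coord X f (param X f x) = x"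
  using homeo homeomorphism_apply1 by blast

lemma param_coord: "f \<in> cells X \<Longrightarrow> p \<in> closure f \<Longrightarrow> param X f (coord X f p) = p"
  using homeo homeomorphism_apply2 by blast

lemma param_in: "f \<in> cells X \<Longrightarrow> x \<in> pdom X f \<Longrightarrow> param X f x \<in> closure f"
  using homeo homeomorphism_image1 by blast

lemma coord_in: "f \<in> cells X \<Longrightarrow> p \<in> closure f \<Longrightarrow> coord X f p \<in> pdom X f"
  using homeo homeomorphism_image2 by blast

lemma coord_Rd: "f \<in> cells X \<Longrightarrow> p \<in> closure f \<Longrightarrow> coord X f p \<in> Rd (cdim X f)"
  using coord_in pdom_subset by blast

text \<open>In a compact space the closure of f is compact, and U_f is its continuous image under
  J_f.\<close>

lemma closed_pdom: "f \<in> cells X \<Longrightarrow> closed (pdom X f)"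
proof -
  assume f: "f \<in> cells X"
  have "compact (closure f)" using compact_space closed_closure by (metis compact_Int_closed inf_top_left)
  then have "compact (coord X f ` closure f)"
    using homeomorphism_cont2[OF homeo[OF f]] compact_continuous_image by blast
  then show ?thesis
    using homeomorphism_image2[OF homeo[OF f]] compact_imp_closed by simp
qed

text \<open>J_f is continuous on the closure of f and maps the dense subset f into the relative
  interior of U_f.\<close>

lemma pdom_closure_interior:
  assumes f: "f \<in> cells X" and x: "x \<in> pdom X f"
  shows "x \<in> closure (interior_Rd (cdim X f) (pdom X f))"
proof -
  let ?I = "interior_Rd (cdim X f) (pdom X f)"
  have "coord X f ` closure f \<subseteq> closure ?I"
  proof (rule image_closure_subset)
    show "continuous_on (closure f) (coord X f)" by (rule homeomorphism_cont2[OF homeo[OF f]])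
    show "coord X f ` f \<subseteq> closure ?I"
    proof
      fix y assume "y \<in> coord X f ` f"
      then have "y \<in> coord X f ` param X f ` ?I" by (simp only: param_interior[OF f])
      then obtain z where "z \<in> ?I" "y = coord X f (param X f z)" by blast
      moreover from this have "z \<in> pdom X f"
        using interior_Rd_subset(1)[of "cdim X f" "pdom X f"] by blast
      ultimately show "y \<in> closure ?I"
        using coord_param[OF f] closure_subset[of ?I] by auto
    qed
  qed simp
  then have "coord X f (param X f x) \<in> closure ?I" using param_in[OF f x] by blast
  then show ?thesis by (simp add: coord_param[OF f x])
qed

lemma pdom_chart_relatively_open:
  assumes f: "f \<in> cells X" and V: "open V"
  obtains W where "open W" "{x \<in> pdom X f. param X f x \<in> V} = pdom X f \<inter> W"
proof -
  have "openin (top_of_set (pdom X f)) (pdom X f \<inter> param X f -` V)"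
    by (rule continuous_openin_preimage_gen[OF homeomorphism_cont1[OF homeo[OF f]] V])
  then obtain W where "open W" "pdom X f \<inter> param X f -` V = pdom X f \<inter> W"
    by (auto simp: openin_open)
  moreover have "{x \<in> pdom X f. param X f x \<in> V} = pdom X f \<inter> param X f -` V" by auto
  ultimately show thesis using that by simp
qed

lemma chart_closure_interior:
  assumes f: "f \<in> cells X" and c: "open V" "x \<in> pdom X f" "param X f x \<in> V"
  shows "x \<in> closure (interior_Rd (cdim X f) {x \<in> pdom X f. param X f x \<in> V})"
proof (rule pdom_chart_relatively_open[OF f c(1)])
  fix W assume W: "open W" "{x \<in> pdom X f. param X f x \<in> V} = pdom X f \<inter> W"
  then have "x \<in> W" using c by blast
  then show ?thesis
    unfolding W(2) using closure_interior_Rd_Int_open[OF pdom_closure_interior[OF f c(2)] W(1)] by simp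
qed

lemma param_extension:
  assumes f: "f \<in> cells X" and c: "(V, \<phi>) \<in> atlas X" and x: "x \<in> pdom X f" "param X f x \<in> V"
  obtains N G where "x \<in> N" "C1_open N G"
    "\<And>y. y \<in> N \<inter> {x \<in> pdom X f. param X f x \<in> V} \<Longrightarrow> G y = \<phi> (param X f y)"
proof -
  obtain N G where "x \<in> N" "C2_open N G" "\<forall>y\<in>N \<inter> {x \<in> pdom X f. param X f x \<in> V}. G y = (\<phi> \<circ> param X f) y"
    using C2_param[OF f c] x unfolding C2_on_def by blast
  then show thesis using that[of N G] C2_open_imp_C1_open by auto
qed

lemma coord_extension:
  assumes f: "f \<in> cells X" and c: "(V, \<phi>) \<in> atlas X" and p: "p \<in> closure f" "p \<in> V"
  obtains N H where "\<phi> p \<in> N" "C1_open N H"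
    "\<And>q. q \<in> V \<Longrightarrow> q \<in> closure f \<Longrightarrow> \<phi> q \<in> N \<Longrightarrow> H (\<phi> q) = coord X f q"
proof -
  have "\<phi> p \<in> \<phi> ` (V \<inter> closure f)" using p by blast
  then obtain N H where N: "\<phi> p \<in> N" "C2_open N H"
    "\<forall>y\<in>N \<inter> \<phi> ` (V \<inter> closure f). H y = (coord X f \<circ> inv_into V \<phi>) y"
    using C2_coord[OF f c] unfolding C2_on_def by blast
  have "H (\<phi> q) = coord X f q" if "q \<in> V" "q \<in> closure f" "\<phi> q \<in> N" for q
    using N(3) that inv_chart[OF c that(1)] by auto
  then show thesis using that[of N H] N C2_open_imp_C1_open by blast
qed

section \<open>Differentials of parametrizations and of transition maps\<close>

lemma dparam_chart:
  assumes f: "f \<in> cells X" and c: "(V, \<phi>) \<in> atlas X" and x: "x \<in> pdom X f" "param X f x \<in> V"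
    and G: "x \<in> N" "C1_open N G"
      "\<And>y. y \<in> N \<inter> {x \<in> pdom X f. param X f x \<in> V} \<Longrightarrow> G y = \<phi> (param X f y)"
    and w: "w \<in> Rd (cdim X f)"
  shows "dparam X f x w (V, \<phi>) = frechet_derivative G (at x) w"
proof -
  have "dparam X f x w (V, \<phi>) = deriv_on {x \<in> pdom X f. param X f x \<in> V} (\<phi> \<circ> param X f) x w"
    using c x by (simp add: dparam_def)
  also have "\<dots> = frechet_derivative G (at x) w"
    by (rule deriv_on_eq[OF G(2) _ G(1) chart_closure_interior[OF f open_chart[OF c] x] w])
      (use G(3) in auto)
  finally show ?thesis .
qed

text \<open>
  Composing local extensions of \<open>\<phi> \<circ> I\<^sub>g\<close> and \<open>J\<^sub>f \<circ> \<phi>\<^sup>-\<^sup>1\<close> extends \<open>J\<^sub>f \<circ> I\<^sub>g\<close> locally.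
\<close>

lemma transition_extension:
  assumes f: "f \<in> cells X" and g: "g \<in> cells X" "closure g \<subseteq> closure f"
    and c: "(V, \<phi>) \<in> atlas X" and y: "y \<in> pdom X g" "param X g y \<in> V"
  obtains N G T H where "y \<in> N" "G y \<in> T" "C1_open N G" "C1_open T H"
    "\<And>z. z \<in> N \<inter> {x \<in> pdom X g. param X g x \<in> V} \<Longrightarrow> G z = \<phi> (param X g z)"
    "\<And>z. z \<in> N \<inter> {x \<in> pdom X g. param X g x \<in> V} \<Longrightarrow> G z \<in> T \<Longrightarrow> H (G z) = coord X f (param X g z)"
proof (rule param_extension[OF g(1) c y])
  fix N G assume G: "y \<in> N" "C1_open N G"
    "\<And>z. z \<in> N \<inter> {x \<in> pdom X g. param X g x \<in> V} \<Longrightarrow> G z = \<phi> (param X g z)"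
  have p: "param X g y \<in> closure f" using param_in[OF g(1) y(1)] g(2) by blast
  show thesis
  proof (rule coord_extension[OF f c p y(2)])
    fix T H assume H: "\<phi> (param X g y) \<in> T" "C1_open T H"
      "\<And>q. q \<in> V \<Longrightarrow> q \<in> closure f \<Longrightarrow> \<phi> q \<in> T \<Longrightarrow> H (\<phi> q) = coord X f q"
    have "H (G z) = coord X f (param X g z)"
      if "z \<in> N \<inter> {x \<in> pdom X g. param X g x \<in> V}" "G z \<in> T" for z
      using H(3)[of "param X g z"] G(3)[OF that(1)] that param_in[OF g(1)] g(2) by auto
    moreover have "G y \<in> T" using H(1) G(1,3) y by auto
    ultimately show thesis using that[OF G(1) _ G(2) H(2)] G(3) by blast
  qed
qed

text \<open>Supplies the regularity needed for negligible images while affinity of the transition is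
  still unknown.\<close>

lemma transition_differentiable:
  assumes f: "f \<in> cells X" and g: "g \<in> cells X" "closure g \<subseteq> closure f"
  shows "(\<lambda>y. coord X f (param X g y)) differentiable_on pdom X g"
  unfolding differentiable_on_def
proof
  fix y assume y: "y \<in> pdom X g"
  obtain V \<phi> where c: "(V, \<phi>) \<in> atlas X" "param X g y \<in> V" by (rule chart_at)
  show "(\<lambda>y. coord X f (param X g y)) differentiable (at y within pdom X g)"
  proof (rule transition_extension[OF f g c(1) y c(2)])
    fix N G T H assume *: "y \<in> N" "G y \<in> T" "C1_open N G" "C1_open T H"
      "\<And>z. z \<in> N \<inter> {x \<in> pdom X g. param X g x \<in> V} \<Longrightarrow> G z \<in> T \<Longrightarrow> H (G z) = coord X f (param X g z)"
    obtain W where W: "open W" "{x \<in> pdom X g. param X g x \<in> V} = pdom X g \<inter> W"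
      by (rule pdom_chart_relatively_open[OF g(1) open_chart[OF c(1)]])
    have C: "C1_open (N \<inter> G -` T) (\<lambda>x. H (G x))" by (rule C1_open_compose[OF *(3,4)])
    have "((\<lambda>x. H (G x)) has_derivative frechet_derivative (\<lambda>x. H (G x)) (at y)) (at y)"
      by (rule C1_open_has_derivative[OF C]) (use * in auto)
    then have D: "((\<lambda>x. H (G x)) has_derivative frechet_derivative (\<lambda>x. H (G x)) (at y)) (at y within pdom X g)"
      by (rule has_derivative_at_withinI)
    have o: "open (N \<inter> G -` T \<inter> W)" using C1_open_open[OF C] W by auto
    have "y \<in> N \<inter> G -` T \<inter> W" using * y c W(2) by blast
    \<comment> \<open>Within distance e every point of U_g stays over the chart and in the domains
      of both extensions, so the composition equals the transition map there.\<close>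
    with o have "\<exists>e>0. \<forall>z. dist z y < e \<longrightarrow> z \<in> N \<inter> G -` T \<inter> W"
      by (simp only: open_dist)
    then obtain e where e: "e > 0" "\<forall>z. dist z y < e \<longrightarrow> z \<in> N \<inter> G -` T \<inter> W" by blast
    have "H (G z) = coord X f (param X g z)" if "z \<in> pdom X g" "dist z y < e" for z
    proof -
      have "z \<in> N" "G z \<in> T" "z \<in> W" using e(2) that(2) by auto
      moreover from this have "z \<in> {x \<in> pdom X g. param X g x \<in> V}" unfolding W(2) using that by blast
      ultimately show ?thesis using *(5)[of z] by blast
    qed
    then have "((\<lambda>y. coord X f (param X g y)) has_derivative frechet_derivative (\<lambda>x. H (G x)) (at y))
        (at y within pdom X g)"
      by (rule has_derivative_transform_within[OF D e(1) y])
    then show ?thesis unfolding differentiable_def by blast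
  qed
qed

text \<open>Local extensions of I_f and J_f, read in one chart, compose to an extension of the
  identity of U_f; by the chain rule the differential of the second is a left inverse to that of the
  first.\<close>

lemma inj_dparam:
  assumes f: "f \<in> cells X" and x: "x \<in> pdom X f"
  shows "inj_on (dparam X f x) (Rd (cdim X f))"
proof -
  obtain V \<phi> where c: "(V, \<phi>) \<in> atlas X" "param X f x \<in> V" by (rule chart_at)
  show ?thesis
  proof (rule transition_extension[OF f f order_refl c(1) x c(2)])
    fix N G T H assume *: "x \<in> N" "G x \<in> T" "C1_open N G" "C1_open T H"
      and G: "\<And>z. z \<in> N \<inter> {x \<in> pdom X f. param X f x \<in> V} \<Longrightarrow> G z = \<phi> (param X f z)"
      and HG: "\<And>z. z \<in> N \<inter> {x \<in> pdom X f. param X f x \<in> V} \<Longrightarrow> G z \<in> T \<Longrightarrow> H (G z) = coord X f (param X f z)"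
    let ?S = "{x \<in> pdom X f. param X f x \<in> V}"
    have id: "C1_open UNIV (\<lambda>x::'n rvec. x)"
      using C1_open_affine[of "\<lambda>x. x" 0] by (simp add: linear_id[unfolded id_def])
    have C: "C1_open (N \<inter> G -` T) (\<lambda>x. H (G x))" by (rule C1_open_compose[OF *(3,4)])
    have left_inverse: "frechet_derivative H (at (G x)) (dparam X f x w (V, \<phi>)) = w"
      if w: "w \<in> Rd (cdim X f)" for w
    proof -
      have "((\<lambda>x. H (G x)) has_derivative (\<lambda>w. frechet_derivative H (at (G x)) (frechet_derivative G (at x) w))) (at x)"
        by (rule has_derivative_compose[OF C1_open_has_derivative[OF *(3,1)] C1_open_has_derivative[OF *(4,2)]])
      then have "frechet_derivative H (at (G x)) (frechet_derivative G (at x) w)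
          = frechet_derivative (\<lambda>x. H (G x)) (at x) w"
        using frechet_derivative_at by metis
      \<comment> \<open>The composition is the identity only on U_f, so its derivative is compared
        only along directions in R^d.\<close>
      also have "\<dots> = frechet_derivative (\<lambda>x. x) (at x) w"
        by (rule C1_agree_derivative[OF C id, of ?S])
          (use * HG coord_param[OF f] chart_closure_interior[OF f open_chart[OF c(1)] x c(2)] w in auto)
      also have "\<dots> = w"
        using frechet_derivative_at[OF has_derivative_ident, of x] by metis
      finally have "frechet_derivative H (at (G x)) (frechet_derivative G (at x) w) = w" .
      moreover have "dparam X f x w (V, \<phi>) = frechet_derivative G (at x) w"
        by (rule dparam_chart[OF f c(1) x c(2) *(1) *(3) _ w]) (rule G)
      ultimately show ?thesis by simp
    qed
    then show ?thesis by (metis inj_onI)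
  qed
qed

lemma dcoord_dparam:
  assumes "f \<in> cells X" "p \<in> closure f" "w \<in> Rd (cdim X f)"
  shows "dcoord X f p (dparam X f (coord X f p) w) = w"
  unfolding dcoord_def
  by (rule inv_into_f_f[OF inj_dparam[OF assms(1) coord_in[OF assms(1,2)]] assms(3)])

lemma dcoord_cell_tangent:
  assumes "f \<in> cells X" "p \<in> closure f" "v \<in> cell_tangent X f p"
  shows "dcoord X f p v \<in> Rd (cdim X f)" "dparam X f (coord X f p) (dcoord X f p v) = v"
  using assms dcoord_dparam[OF assms(1,2)] by (auto simp: cell_tangent_def)

section \<open>Trimmed spaces in coordinates\<close>

lemma pull_coord_cong:
  assumes f: "f \<in> cells X"
    and eq: "\<And>x vs. x \<in> pdom X f \<Longrightarrow> x \<in> Rd (cdim X f) \<Longrightarrow> set vs \<subseteq> Rd (cdim X f) \<Longrightarrow> \<alpha> x vs = \<beta> x vs"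
  shows "pull_coord X f \<alpha> = pull_coord X f \<beta>"
proof (intro ext)
  fix p vs
  show "pull_coord X f \<alpha> p vs = pull_coord X f \<beta> p vs"
  proof (cases "p \<in> closure f \<and> set vs \<subseteq> cell_tangent X f p")
    case True
    then have "set (map (dcoord X f p) vs) \<subseteq> Rd (cdim X f)"
      using dcoord_cell_tangent(1)[OF f] by auto
    then show ?thesis
      using True eq[of "coord X f p" "map (dcoord X f p) vs"] coord_in[OF f] coord_Rd[OF f]
      by (auto simp: pull_coord_def)
  next
    case False
    then show ?thesis by (auto simp: pull_coord_def)
  qed
qed

lemma pull_param_pull_coord:
  assumes f: "f \<in> cells X" and x: "x \<in> pdom X f" and ws: "set ws \<subseteq> Rd (cdim X f)"
  shows "pull_param X f (pull_coord X f \<alpha>) x ws = \<alpha> x ws"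
proof -
  have p: "param X f x \<in> closure f" "coord X f (param X f x) = x"
    using param_in[OF f x] coord_param[OF f x] by auto
  then have "map (dcoord X f (param X f x) \<circ> dparam X f x) ws = ws"
    using dcoord_dparam[OF f p(1)] ws by (intro map_idI) auto
  then show ?thesis
    using x ws p by (auto simp: pull_param_def pull_coord_def cell_tangent_def)
qed

text \<open>Returning to U_f recovers \<alpha>, whose coefficients agree there with polynomials;
  these serve as global C^1 extensions in \<open>deriv_on\<close>, at frontier points too.\<close>

lemma ext_deriv_pull_coord:
  assumes f: "f \<in> cells X" and a: "\<alpha> \<in> pform r l (cdim X f)"
  shows "ext_deriv X f (pull_coord X f \<alpha>) = pull_coord X f (extd (cdim X f) \<alpha>)"
  unfolding ext_deriv_def
proof (rule pull_coord_cong[OF f])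
  fix x and vs :: "'n rvec list"
  assume x: "x \<in> pdom X f" "x \<in> Rd (cdim X f)" and vs: "set vs \<subseteq> Rd (cdim X f)"
  let ?P = "pull_param X f (pull_coord X f \<alpha>)"
  have "deriv_on (pdom X f) (\<lambda>y. ?P y (omit i vs)) x (vs ! i) = dird \<alpha> x (vs ! i) (omit i vs)"
    if "i < length vs" for i
  proof (rule pform_gradient[OF a, of "omit i vs"])
    fix p and g :: "'n \<Rightarrow> 'n rvec \<Rightarrow> real"
    assume p: "p \<in> polynomials r" "\<And>x. x \<in> Rd (cdim X f) \<Longrightarrow> \<alpha> x (omit i vs) = p x"
      and d: "\<And>x. (p has_derivative (\<lambda>v. \<Sum>i\<in>UNIV. v $ i * g i x)) (at x)"
        "\<And>x v. x \<in> Rd (cdim X f) \<Longrightarrow> v \<in> Rd (cdim X f) \<Longrightarrow>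
          dird \<alpha> x v (omit i vs) = (\<Sum>i\<in>UNIV. v $ i * g i x)"
    have vi: "vs ! i \<in> Rd (cdim X f)" and o: "set (omit i vs) \<subseteq> Rd (cdim X f)"
      using that vs set_omit[of i vs] by auto
    have "deriv_on (pdom X f) (\<lambda>y. ?P y (omit i vs)) x (vs ! i) = frechet_derivative p (at x) (vs ! i)"
    proof (rule deriv_on_eq[OF C1_open_polynomial[OF p(1)] _ _ pdom_closure_interior[OF f x(1)] vi])
      fix y assume "y \<in> UNIV \<inter> pdom X f"
      then show "p y = ?P y (omit i vs)"
        using p(2) pdom_subset[OF f] pull_param_pull_coord[OF f _ o] by auto
    qed simp
    also have "\<dots> = dird \<alpha> x (vs ! i) (omit i vs)"
      unfolding d(2)[OF x(2) vi]
      by (rule fun_cong[OF frechet_derivative_at[OF d(1), symmetric]])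
    finally show ?thesis .
  qed
  then show "ext_deriv_Rd (cdim X f) (pdom X f) ?P x vs = extd (cdim X f) \<alpha> x vs"
    using x vs by (simp add: ext_deriv_Rd_def extd_def omit_def)
qed

text \<open>The differential of J_f sends the radial field at p to the coordinate vector of p
  itself.\<close>

lemma kappa_pull_coord:
  assumes f: "f \<in> cells X"
  shows "kappa X f (pull_coord X f \<beta>) = pull_coord X f (koszul \<beta>)"
proof (intro ext)
  fix p vs
  show "kappa X f (pull_coord X f \<beta>) p vs = pull_coord X f (koszul \<beta>) p vs"
  proof (cases "p \<in> closure f")
    case True
    then have "radial_field X f p \<in> cell_tangent X f p"
      "dcoord X f p (radial_field X f p) = coord X f p"
      using coord_Rd[OF f True] dcoord_dparam[OF f True] by (auto simp: radial_field_def cell_tangent_def)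
    then show ?thesis
      by (simp add: kappa_def interior_product_def pull_coord_def koszul_def)
  next
    case False
    then show ?thesis by (simp add: kappa_def interior_product_def pull_coord_def)
  qed
qed

lemma trimmed_0:
  "trimmed X r 0 f = pull_coord X f ` pform r 0 (cdim X f)"
  by (simp add: trimmed_def cell_poly_def poly_forms_eq_pform[of r 0, simplified])

text \<open>Pullback by J_f is additive and intertwines d and kappa with \<open>extd\<close> and
  \<open>koszul\<close>, which reduces trimmed spaces to forms on R^d. Writing the degree as
  \<open>Suc l\<close> keeps both neighbouring degrees natural numbers.\<close>

lemma trimmed_Suc:
  assumes f: "f \<in> cells X"
  shows "trimmed X r (int (Suc l)) f = {pull_coord X f (\<lambda>x vs. extd (cdim X f) \<alpha> x vs + koszul \<beta> x vs) | \<alpha> \<beta>.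
    \<alpha> \<in> pform r l (cdim X f) \<and> \<beta> \<in> pform (r - 1) (Suc (Suc l)) (cdim X f)}" (is "?L = ?R")
proof -
  let ?d = "cdim X f"
  have e: "int (Suc l) - 1 = int l" "int (Suc l) + 1 = int (Suc (Suc l))" by auto
  have add: "(\<lambda>p vs. pull_coord X f \<alpha> p vs + pull_coord X f \<beta> p vs) = pull_coord X f (\<lambda>x vs. \<alpha> x vs + \<beta> x vs)"
    for \<alpha> \<beta> by (auto simp: fun_eq_iff pull_coord_def)
  have "?L = {(\<lambda>p vs. \<mu> p vs + \<nu> p vs) | \<mu> \<nu>.
      \<mu> \<in> ext_deriv X f ` pull_coord X f ` pform r l ?d \<and>
      \<nu> \<in> kappa X f ` pull_coord X f ` pform (r - 1) (Suc (Suc l)) ?d}"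
    unfolding trimmed_def cell_poly_def e poly_forms_eq_pform by simp
  also have "ext_deriv X f ` pull_coord X f ` pform r l ?d = (\<lambda>\<alpha>. pull_coord X f (extd ?d \<alpha>)) ` pform r l ?d"
    unfolding image_image using ext_deriv_pull_coord[OF f] by (intro image_cong) auto
  also have "kappa X f ` pull_coord X f ` pform (r - 1) (Suc (Suc l)) ?d
      = (\<lambda>\<beta>. pull_coord X f (koszul \<beta>)) ` pform (r - 1) (Suc (Suc l)) ?d"
    unfolding image_image using kappa_pull_coord[OF f] by (intro image_cong) auto
  also have "{(\<lambda>p vs. \<mu> p vs + \<nu> p vs) | \<mu> \<nu>.
      \<mu> \<in> (\<lambda>\<alpha>. pull_coord X f (extd ?d \<alpha>)) ` pform r l ?d \<and>
      \<nu> \<in> (\<lambda>\<beta>. pull_coord X f (koszul \<beta>)) ` pform (r - 1) (Suc (Suc l)) ?d} = ?R" (is "?A = _")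
  proof (intro equalityI subsetI)
    fix \<omega> assume "\<omega> \<in> ?A"
    then obtain \<alpha> \<beta> where "\<alpha> \<in> pform r l ?d" "\<beta> \<in> pform (r - 1) (Suc (Suc l)) ?d"
      "\<omega> = (\<lambda>p vs. pull_coord X f (extd ?d \<alpha>) p vs + pull_coord X f (koszul \<beta>) p vs)"
      by auto
    then show "\<omega> \<in> ?R" unfolding add by auto
  next
    fix \<omega> assume "\<omega> \<in> ?R"
    then obtain \<alpha> \<beta> where "\<alpha> \<in> pform r l ?d" "\<beta> \<in> pform (r - 1) (Suc (Suc l)) ?d"
      "\<omega> = pull_coord X f (\<lambda>x vs. extd ?d \<alpha> x vs + koszul \<beta> x vs)"
      by auto
    then show "\<omega> \<in> ?A" unfolding add[symmetric] by auto
  qed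
  finally show ?thesis .
qed

end

section \<open>Frontiers of codimension at least two\<close>

lemma rank_exists:
  assumes "m < CARD('n::{finite,linorder})"
  obtains j :: "'n::{finite,linorder}" where "card {..<j} = m"
proof -
  have "range (\<lambda>j :: 'n. card {..<j}) = {..<CARD('n)}"
  proof (rule card_subset_eq)
    have "card {..<j} < CARD('n)" for j :: 'n
      by (intro psubset_card_mono) auto
    then show "range (\<lambda>j :: 'n. card {..<j}) \<subseteq> {..<CARD('n)}" by auto
    show "card (range (\<lambda>j :: 'n. card {..<j})) = card {..<CARD('n)}"
      by (simp add: card_image[OF inj_rank])
  qed simp
  then have "m \<in> range (\<lambda>j :: 'n. card {..<j})" using assms by simp
  then show thesis using that by blast
qed

definition proj_Rd :: "nat \<Rightarrow> 'n::{finite,linorder} rvec \<Rightarrow> 'n rvec" where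
  "proj_Rd k x = (\<chi> i. if card {..<i} < k then x $ i else 0)"

lemma linear_proj_Rd: "linear (proj_Rd k)"
  by (rule linearI) (auto simp: proj_Rd_def vec_eq_iff)

lemma proj_Rd_in: "proj_Rd k x \<in> Rd k"
  by (simp add: proj_Rd_def Rd_def)

lemma proj_Rd_id: "x \<in> Rd k \<Longrightarrow> proj_Rd k x = x"
  by (auto simp: proj_Rd_def Rd_def vec_eq_iff)

lemma Rd_mono: "k \<le> d \<Longrightarrow> Rd k \<subseteq> Rd d"
  by (auto simp: Rd_def)

text \<open>
  The cone with apex \<open>a\<close> over a differentiable image of a set of dimension \<open>d - 2\<close> is negligible in
  \<open>\<real>\<^sup>d\<close>; it is thickened by the orthogonal complement of \<open>Rd d\<close> to get a negligible subset of the
  ambient space.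
\<close>

lemma negligible_thickened_cone:
  fixes T :: "'n::{finite,linorder} rvec \<Rightarrow> 'n rvec"
  assumes kd: "k + 2 \<le> d" "d \<le> CARD('n)" and W: "W \<subseteq> Rd k" and T: "T differentiable_on W"
  shows "negligible {z. \<exists>s\<in>W. \<exists>t. proj_Rd d z = a + t *\<^sub>R (T s - a)}"
proof -
  obtain j1 j2 :: 'n where j: "card {..<j1} = k" "card {..<j2} = k + 1"
    using rank_exists[of k, where 'n = 'n] rank_exists[of "k + 1", where 'n = 'n] kd
    by (metis Suc_1 Suc_eq_plus1 add_Suc_right less_le_trans lessI less_SucI)
  define D where "D = {z :: 'n rvec. z $ j2 = 0 \<and> proj_Rd k z \<in> W}"
  \<comment> \<open>The images of W leave the coordinates j1 and j2 of R^d free: j1 carries the cone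
    parameter, j2 is kept at 0 and puts \<open>D\<close> into a hyperplane. This is where
    codimension two is spent. Coordinates beyond d pass through unchanged.\<close>
  define \<Phi> where "\<Phi> z = a + (z $ j1) *\<^sub>R (T (proj_Rd k z) - a) + (z - proj_Rd d z)" for z
  have "negligible {z :: 'n rvec. z \<bullet> axis j2 1 = 0}"
    by (rule negligible_standard_hyperplane) (simp add: axis_in_Basis_iff)
  then have "negligible D"
    by (rule negligible_subset) (auto simp: D_def inner_axis)
  moreover have "\<Phi> differentiable_on D"
  proof -
    have "(\<lambda>z. T (proj_Rd k z)) differentiable_on D"
      by (rule differentiable_on_compose[OF linear_imp_differentiable_on[OF linear_proj_Rd]])
        (rule differentiable_on_subset[OF T], auto simp: D_def)
    moreover have "(\<lambda>z. z $ j1) differentiable_on D"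
      by (intro linear_imp_differentiable_on linearI) auto
    moreover have "proj_Rd d differentiable_on D"
      by (rule linear_imp_differentiable_on[OF linear_proj_Rd])
    moreover have "(\<lambda>z::'n rvec. z) differentiable_on D"
      by (intro linear_imp_differentiable_on linearI) auto
    ultimately show ?thesis
      unfolding \<Phi>_def[abs_def]
      by (intro differentiable_on_add differentiable_on_diff differentiable_on_scaleR differentiable_on_const)
  qed
  ultimately have "negligible (\<Phi> ` D)"
    by (intro negligible_differentiable_image_negligible) auto
  moreover have "{z. \<exists>s\<in>W. \<exists>t. proj_Rd d z = a + t *\<^sub>R (T s - a)} \<subseteq> \<Phi> ` D"
  proof clarify
    fix z s t assume s: "s \<in> W" and z: "proj_Rd d z = a + t *\<^sub>R (T s - a)"
    \<comment> \<open>Preimage of z under \<Phi>: base point s in the first k coordinates, cone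
      parameter at j1, and the part of z orthogonal to R^d.\<close>
    define y where "y = s + t *\<^sub>R axis j1 1 + (z - proj_Rd d z)"
    have sk: "s $ i = 0" if "k \<le> card {..<i}" for i
      using s W that by (auto simp: Rd_def)
    have ne: "j1 \<noteq> j2" using j by auto
    have y1: "y $ j1 = t" using j kd sk[of j1] by (simp add: y_def proj_Rd_def)
    have y2: "y $ j2 = 0" using j kd ne sk[of j2] by (simp add: y_def proj_Rd_def axis_def)
    have pk: "proj_Rd k y = s"
      using j(1) kd by (auto simp: vec_eq_iff proj_Rd_def y_def axis_def sk not_less)
    have pd: "y - proj_Rd d y = z - proj_Rd d z"
      using j(1) kd by (auto simp: vec_eq_iff proj_Rd_def y_def axis_def sk not_less)
    have "\<Phi> y = z" unfolding \<Phi>_def y1 pk pd z[symmetric] by (simp add: z)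
    moreover have "y \<in> D" using y2 pk s by (simp add: D_def)
    ultimately show "z \<in> \<Phi> ` D" by blast
  qed
  ultimately show ?thesis by (rule negligible_subset)
qed

text \<open>Points near x but outside U form a set of positive measure after thickening, so some
  such b avoids every cone from an interior point a. The segment from a to b still meets the
  frontier, and the meeting point puts b on a cone.\<close>

lemma frontier_not_codim_2:
  fixes U :: "'n::{finite,linorder} rvec set" and W :: "'i \<Rightarrow> 'n rvec set"
  assumes U: "closed U" "U \<subseteq> Rd d" and kd: "k + 2 \<le> d" "d \<le> CARD('n)"
    and x: "x \<in> closure (interior_Rd d U)" "x \<in> Rd d" "x \<notin> interior_Rd d U" and e: "e > 0"
    and I: "finite I" and W: "\<And>i. i \<in> I \<Longrightarrow> W i \<subseteq> Rd k"
    and T: "\<And>i. i \<in> I \<Longrightarrow> T i differentiable_on W i"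
    and cover: "\<And>y. y \<in> U \<Longrightarrow> y \<notin> interior_Rd d U \<Longrightarrow> dist y x < e \<Longrightarrow> \<exists>i\<in>I. y \<in> T i ` W i"
  shows False
proof -
  obtain a where a: "a \<in> interior_Rd d U" "dist a x < e"
    using x(1) e unfolding closure_approachable by blast
  have aR: "a \<in> Rd d" "a \<in> U" using a interior_Rd_subset by blast+
  \<comment> \<open>Open by closedness of U, and nonempty because x is not a relative interior
    point; the projection thickens it so that Lebesgue measure on the ambient space applies.\<close>
  define B where "B = {z :: 'n rvec. dist (proj_Rd d z) x < e \<and> proj_Rd d z \<notin> U}"
  have cont: "continuous_on UNIV (proj_Rd d :: 'n rvec \<Rightarrow> 'n rvec)"
    by (simp add: linear_continuous_on linear_proj_Rd linear_linear)
  have "B = proj_Rd d -` (ball x e \<inter> - U)" by (auto simp: B_def dist_commute)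
  moreover have "open (proj_Rd d -` (ball x e \<inter> - U))"
    using U(1) by (intro open_vimage cont) auto
  ultimately have "open B" by simp
  moreover have "B \<noteq> {}"
  proof -
    obtain z where "z \<in> Rd d" "dist z x < e" "z \<notin> U"
      using x(2,3) e unfolding interior_Rd_iff by blast
    then have "z \<in> B" by (simp add: B_def proj_Rd_id)
    then show ?thesis by blast
  qed
  ultimately have "\<not> negligible B" by (rule open_not_negligible)
  moreover have "negligible (\<Union>i\<in>I. {z. \<exists>s\<in>W i. \<exists>t. proj_Rd d z = a + t *\<^sub>R (T i s - a)})"
    using I W T by (auto intro!: negligible_Union negligible_thickened_cone[OF kd])
  ultimately have "\<not> B \<subseteq> (\<Union>i\<in>I. {z. \<exists>s\<in>W i. \<exists>t. proj_Rd d z = a + t *\<^sub>R (T i s - a)})"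
    using negligible_subset by blast
  then obtain z where z: "z \<in> B"
    and nz: "z \<notin> (\<Union>i\<in>I. {z. \<exists>s\<in>W i. \<exists>t. proj_Rd d z = a + t *\<^sub>R (T i s - a)})"
    by blast
  define b where "b = proj_Rd d z"
  have b: "b \<in> Rd d" "dist b x < e" "b \<notin> U"
    using z proj_Rd_in by (auto simp: B_def b_def)
  have seg: "closed_segment a b \<subseteq> Rd d"
    by (rule closed_segment_subset[OF aR(1) b(1) subspace_imp_convex[OF subspace_Rd]])
  \<comment> \<open>Convexity of the ball keeps the crossing point close enough to x for
    \<open>cover\<close> to apply.\<close>
  have ball: "closed_segment a b \<subseteq> ball x e"
    by (rule closed_segment_subset) (use a b in \<open>auto simp: dist_commute\<close>)
  obtain O1 where O1: "open O1" "interior_Rd d U = Rd d \<inter> O1"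
    using openin_interior_Rd[of d U] by (auto simp: openin_open)
  \<comment> \<open>Otherwise the relative interior and the complement of U would disconnect the
    segment, a lying in the one and b in the other.\<close>
  have "\<exists>c\<in>closed_segment a b. c \<in> U \<and> c \<notin> interior_Rd d U"
  proof (rule ccontr)
    assume c: "\<not> (\<exists>c\<in>closed_segment a b. c \<in> U \<and> c \<notin> interior_Rd d U)"
    have "O1 \<inter> closed_segment a b = {} \<or> - U \<inter> closed_segment a b = {}"
    proof (rule connectedD[OF connected_segment(1) O1(1)])
      show "open (- U)" using U(1) by auto
      show "O1 \<inter> - U \<inter> closed_segment a b = {}"
        using seg O1(2) interior_Rd_subset(1)[of d U] by blast
      show "closed_segment a b \<subseteq> O1 \<union> - U" using c O1(2) by blast
    qed
    then show False using a(1) O1(2) b(3) by auto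
  qed
  then obtain c where c: "c \<in> closed_segment a b" "c \<in> U" "c \<notin> interior_Rd d U" by blast
  then obtain u where u: "c = (1 - u) *\<^sub>R a + u *\<^sub>R b" unfolding in_segment by blast
  have "u \<noteq> 0" using u c(3) a(1) by auto
  have "dist c x < e" using c(1) ball by (auto simp: dist_commute)
  then obtain i s where i: "i \<in> I" "s \<in> W i" "c = T i s" using cover[OF c(2,3)] by blast
  have "c - a = u *\<^sub>R (b - a)" unfolding u by (simp add: algebra_simps)
  then have "b = a + (1 / u) *\<^sub>R (T i s - a)" using \<open>u \<noteq> 0\<close> i(3) by simp
  then show False using nz i(1,2) unfolding b_def by blast
qed

section \<open>Transitions between a cell and its subcells\<close>

context affine_mesh
begin

lemma finite_cells: "finite (cells X)"
  using mesh by (simp add: is_mesh_def)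

lemma cdim_le: "f \<in> cells X \<Longrightarrow> cdim X f \<le> CARD('n)"
  using mesh by (simp add: is_mesh_def)

lemma subset_bdry:
  "f \<in> cells X \<Longrightarrow> g \<in> cells X \<Longrightarrow> cdim X g < cdim X f \<Longrightarrow> g \<inter> closure f \<noteq> {} \<Longrightarrow> g \<subseteq> bdry f"
proof -
  assume *: "f \<in> cells X" "g \<in> cells X" "cdim X g < cdim X f" "g \<inter> closure f \<noteq> {}"
  have "\<forall>f\<in>cells X. \<forall>f'\<in>cells X.
      1 \<le> cdim X f \<and> cdim X f' < cdim X f \<and> f' \<inter> closure f \<noteq> {} \<longrightarrow> f' \<subseteq> bdry f"
    using mesh by (simp add: is_mesh_def)
  then show "g \<subseteq> bdry f" using * by simp
qed

lemma bdry_covered: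
  "f \<in> cells X \<Longrightarrow> q \<in> bdry f \<Longrightarrow> \<exists>g\<in>cells X. cdim X g < cdim X f \<and> q \<in> g"
proof -
  assume *: "f \<in> cells X" "q \<in> bdry f"
  have "\<forall>f\<in>cells X. bdry f \<subseteq> \<Union> {f' \<in> cells X. cdim X f' < cdim X f}"
    using mesh by (simp add: is_mesh_def)
  then show ?thesis using * by blast
qed

lemma closure_subset_closure: "g \<subseteq> bdry f \<Longrightarrow> closure g \<subseteq> closure f"
  by (rule closure_minimal) (auto simp: bdry_def)

text \<open>If a point p of f' avoids the closures of all facets, so do its neighbours, there being
  finitely many facets. Near J_f(p) the frontier of U_f is then covered by cells of codimension at
  least two, against \<open>frontier_not_codim_2\<close>.\<close>

lemma facet_exists:
  assumes f: "f \<in> cells X" and f': "f' \<in> cells X" "f' \<subseteq> bdry f" "f' \<noteq> {}"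
    and dim: "cdim X f' + 2 \<le> cdim X f"
  obtains g where "g \<in> cells X" "Suc (cdim X g) = cdim X f" "g \<subseteq> bdry f" "f' \<inter> closure g \<noteq> {}"
proof (rule ccontr)
  assume no: "\<not> thesis"
  let ?d = "cdim X f" and ?U = "pdom X f"
  define F where "F = \<Union> (closure ` {g \<in> cells X. Suc (cdim X g) = ?d \<and> g \<subseteq> bdry f})"
  obtain p where p: "p \<in> f'" using f'(3) by blast
  have "closed F" unfolding F_def using finite_cells by (intro closed_Union) auto
  have pF: "p \<notin> F" using no that p unfolding F_def by blast
  have pf: "p \<in> closure f" "p \<notin> f" using p f'(2) by (auto simp: bdry_def)
  define x where "x = coord X f p"
  have x: "x \<in> ?U" "param X f x = p" using coord_in[OF f pf(1)] param_coord[OF f pf(1)] by (auto simp: x_def)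
  have xn: "x \<notin> interior_Rd ?d ?U" using param_interior[OF f] x(2) pf(2) by blast
  obtain W where W: "open W" "{x \<in> ?U. param X f x \<in> - F} = ?U \<inter> W"
    by (rule pdom_chart_relatively_open[OF f open_Compl[OF \<open>closed F\<close>]])
  have "x \<in> W" using x pF W(2) by blast
  then obtain e where e: "e > 0" "ball x e \<subseteq> W" using W(1) open_contains_ball by blast
  define I where "I = {g \<in> cells X. cdim X g + 2 \<le> ?d \<and> g \<subseteq> bdry f}"
  show False
  proof (rule frontier_not_codim_2[of ?U ?d "?d - 2" x e I "pdom X" "\<lambda>g y. coord X f (param X g y)"])
    show "closed ?U" by (rule closed_pdom[OF f])
    show "?U \<subseteq> Rd ?d" by (rule pdom_subset[OF f])
    then show "x \<in> Rd ?d" using x(1) by blast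
    show "?d - 2 + 2 \<le> ?d" using dim by simp
    show "?d \<le> CARD('n)" by (rule cdim_le[OF f])
    show "x \<in> closure (interior_Rd ?d ?U)" by (rule pdom_closure_interior[OF f x(1)])
    show "finite I" using finite_cells by (simp add: I_def)
    show "pdom X g \<subseteq> Rd (?d - 2)" if "g \<in> I" for g
    proof -
      have "Rd (cdim X g) \<subseteq> (Rd (?d - 2) :: 'n rvec set)" using that by (intro Rd_mono) (auto simp: I_def)
      then show ?thesis using pdom_subset[of g] that by (auto simp: I_def)
    qed
    show "(\<lambda>y. coord X f (param X g y)) differentiable_on pdom X g" if "g \<in> I" for g
      using that by (intro transition_differentiable[OF f] closure_subset_closure) (auto simp: I_def)
    show "\<exists>g\<in>I. y \<in> (\<lambda>y. coord X f (param X g y)) ` pdom X g"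
      if y: "y \<in> ?U" "y \<notin> interior_Rd ?d ?U" "dist y x < e" for y
    proof -
      define q where "q = param X f y"
      have q: "q \<in> closure f" "coord X f q = y"
        using param_in[OF f y(1)] coord_param[OF f y(1)] by (auto simp: q_def)
      \<comment> \<open>By injectivity of I_f, only the relative interior of U_f is mapped into
        f.\<close>
      have "q \<notin> f"
      proof
        assume "q \<in> f"
        then have "q \<in> param X f ` interior_Rd ?d ?U" by (simp only: param_interior[OF f])
        then obtain z where "z \<in> interior_Rd ?d ?U" "q = param X f z" by blast
        moreover from this have "z \<in> ?U" using interior_Rd_subset(1)[of ?d ?U] by blast
        ultimately show False using coord_param[OF f] q(2) y(2) by metis
      qed
      then have "q \<in> bdry f" using q(1) by (simp add: bdry_def)
      then obtain g where g: "g \<in> cells X" "cdim X g < ?d" "q \<in> g" using bdry_covered[OF f] by blast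
      then have gb: "g \<subseteq> bdry f" using subset_bdry[OF f g(1,2)] q(1) by blast
      have qg: "q \<in> closure g" using g(3) closure_subset by blast
      have "y \<in> W" using e(2) y(3) by (auto simp: dist_commute)
      then have "q \<notin> F" using W(2) y(1) unfolding q_def by blast
      then have "Suc (cdim X g) \<noteq> ?d" using qg g(1) gb unfolding F_def by blast
      then have "g \<in> I" using g gb by (simp add: I_def)
      moreover have "y = coord X f (param X g (coord X g q))" by (simp add: param_coord[OF g(1) qg] q(2))
      ultimately show ?thesis using coord_in[OF g(1) qg] by blast
    qed
  qed (use xn e in auto)
qed

text \<open>A facet g whose closure meets f' contains f' in its boundary by
  \<open>subset_bdry\<close>, so the induction hypothesis applies to g. The transition from f' to f
  then factors through U_g as a composition of two affine maps.\<close>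

lemma transition_affine:
  assumes f': "f' \<in> cells X" "f' \<noteq> {}"
  shows "f \<in> cells X \<Longrightarrow> f' \<subseteq> bdry f \<Longrightarrow> cdim X f' < cdim X f \<Longrightarrow>
    \<exists>L b. linear L \<and> (\<forall>x\<in>pdom X f'. coord X f (param X f' x) = L x + b)"
proof (induction "cdim X f" arbitrary: f rule: less_induct)
  case less
  note f = less.prems(1)
  have facet: "\<exists>L b. linear L \<and> (\<forall>x\<in>pdom X g. coord X f (param X g x) = L x + b)"
    if "g \<in> cells X" "Suc (cdim X g) = cdim X f" "g \<subseteq> bdry f" for g
  proof -
    have "g \<in> subcells X (cdim X g) f" using that by (simp add: subcells_def cells_of_dim_def)
    then show ?thesis using coordinates f that(2) unfolding affine_compatible_coordinates_def by blast
  qed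
  show ?case
  proof (cases "Suc (cdim X f') = cdim X f")
    case True
    then show ?thesis using facet f' less.prems by blast
  next
    case False
    then have dim: "cdim X f' + 2 \<le> cdim X f" using less.prems(3) by simp
    show ?thesis
    proof (rule facet_exists[OF f f'(1) less.prems(2) f'(2) dim])
      fix g assume g: "g \<in> cells X" "Suc (cdim X g) = cdim X f" "g \<subseteq> bdry f" "f' \<inter> closure g \<noteq> {}"
      have lt: "cdim X f' < cdim X g" "cdim X g < cdim X f" using g(2) dim by auto
      have sub: "f' \<subseteq> bdry g" by (rule subset_bdry[OF g(1) f'(1) lt(1) g(4)])
      obtain L b where L: "linear L" "\<And>x. x \<in> pdom X f' \<Longrightarrow> coord X g (param X f' x) = L x + b"
        using less.hyps[OF lt(2) g(1) sub lt(1)] by blast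
      obtain M c where M: "linear M" "\<And>x. x \<in> pdom X g \<Longrightarrow> coord X f (param X g x) = M x + c"
        using facet[OF g(1-3)] by blast
      have "coord X f (param X f' x) = (M \<circ> L) x + (M b + c)" if x: "x \<in> pdom X f'" for x
      proof -
        have q: "param X f' x \<in> closure g"
          using param_in[OF f'(1) x] closure_subset_closure[OF sub] by blast
        have "coord X f (param X f' x) = M (coord X g (param X f' x)) + c"
          using M(2)[OF coord_in[OF g(1) q]] by (simp add: param_coord[OF g(1) q])
        then show ?thesis by (simp add: L(2)[OF x] linear_add[OF M(1)] add.assoc)
      qed
      moreover have "linear (M \<circ> L)" by (rule linear_compose[OF L(1) M(1)])
      ultimately show ?thesis by blast
    qed
  qed
qed

text \<open>The affine formula is known only on U_f', but for nonempty f' this set contains a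
  relative ball. Differences of its values control L on all small vectors, hence on all of R^d', and
  then b as well.\<close>

lemma transition_affine_Rd:
  assumes f: "f \<in> cells X" and f': "f' \<in> cells X" "closure f' \<subseteq> closure f" "f' \<noteq> {}"
    and L: "linear L" and T: "\<And>x. x \<in> pdom X f' \<Longrightarrow> coord X f (param X f' x) = L x + b"
  shows "x \<in> Rd (cdim X f') \<Longrightarrow> L x \<in> Rd (cdim X f)" and "b \<in> Rd (cdim X f)"
proof -
  have TR: "L y + b \<in> Rd (cdim X f)" if "y \<in> pdom X f'" for y
    using coord_Rd[OF f, of "param X f' y"] param_in[OF f'(1) that] f'(2) T[OF that] by auto
  have "interior_Rd (cdim X f') (pdom X f') \<noteq> {}"
    using param_interior[OF f'(1)] f'(3) by auto
  then obtain y where "y \<in> interior_Rd (cdim X f') (pdom X f')" by blast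
  then obtain e where y: "y \<in> Rd (cdim X f')" and e: "e > 0"
    and ball: "\<And>z. z \<in> Rd (cdim X f') \<Longrightarrow> dist z y < e \<Longrightarrow> z \<in> pdom X f'"
    unfolding interior_Rd_iff by blast
  have LR: "L x \<in> Rd (cdim X f)" if x: "x \<in> Rd (cdim X f')" for x
  proof -
    \<comment> \<open>Scales x to a length below e; the summand 1 covers x = 0.\<close>
    define t where "t = e / (norm x + 1)"
    have n: "norm x + 1 > 0" by (simp add: add_nonneg_pos)
    have t: "t > 0" using e n by (simp add: t_def)
    have "norm (t *\<^sub>R x) < e"
      using e n by (simp add: t_def field_simps)
    then have "y + t *\<^sub>R x \<in> pdom X f'" using x y by (intro ball Rd_add Rd_scale) (auto simp: dist_norm)
    then have "(L (y + t *\<^sub>R x) + b) - (L y + b) \<in> Rd (cdim X f)"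
      using y e ball by (intro Rd_diff TR) auto
    then have "t *\<^sub>R L x \<in> Rd (cdim X f)" by (simp add: linear_add[OF L] linear_scale[OF L])
    from Rd_scale[OF this, of "1 / t"] show ?thesis using t by simp
  qed
  then show "x \<in> Rd (cdim X f') \<Longrightarrow> L x \<in> Rd (cdim X f)" by blast
  have "(L y + b) - L y \<in> Rd (cdim X f)" using y e ball by (intro Rd_diff TR LR) auto
  then show "b \<in> Rd (cdim X f)" by simp
qed

lemma subcell_transition:
  assumes f: "f \<in> cells X" and f': "f' \<in> subcells X d' f"
  obtains L b where "f' \<in> cells X" "closure f' \<subseteq> closure f" "linear L"
    "\<And>x. x \<in> Rd (cdim X f') \<Longrightarrow> L x \<in> Rd (cdim X f)" "b \<in> Rd (cdim X f)"
    "\<And>x. x \<in> pdom X f' \<Longrightarrow> coord X f (param X f' x) = L x + b"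
proof (cases "d' = cdim X f")
  case True
  then have "f' = f" using f' by (simp add: subcells_def)
  then show thesis
    using f coord_param[OF f] Rd_0 by (intro that[of "\<lambda>x. x" 0]) (auto simp: linear_id[unfolded id_def])
next
  case False
  then have f'c: "f' \<in> cells X" "f' \<subseteq> bdry f"
    using f' by (auto simp: subcells_def cells_of_dim_def)
  show thesis
  proof (cases "f' = {}")
    \<comment> \<open>An empty cell has an empty U_f', so the transition formula holds vacuously for
      the zero map.\<close>
    case True
    then have "pdom X f' = {}" using param_in[OF f'c(1)] by auto
    then show thesis
      using f'c(1) True Rd_0 by (intro that[of "\<lambda>_. 0" 0]) (auto simp: linear_zero)
  next
    case False
    then obtain q where q: "q \<in> f'" by blast
    then obtain g where g: "g \<in> cells X" "cdim X g < cdim X f" "q \<in> g"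
      using bdry_covered[OF f] f'c(2) by blast
    \<comment> \<open>\<open>subcells\<close> does not itself say that f' has lower dimension. The
      boundary point q lies in a cell of lower dimension, and disjointness identifies that cell with
      f'.\<close>
    have "disjoint (cells X)" using mesh by (simp add: is_mesh_def)
    then have "g = f'" using g f'c(1) q unfolding disjoint_def by blast
    then obtain L b where L: "linear L" "\<And>x. x \<in> pdom X f' \<Longrightarrow> coord X f (param X f' x) = L x + b"
      using transition_affine[OF f'c(1) False f f'c(2)] g(2) by blast
    note sub = closure_subset_closure[OF f'c(2)]
    show thesis
      using that[OF f'c(1) sub L(1) _ _ L(2)] transition_affine_Rd[OF f f'c(1) sub False L] by blast
  qed
qed

section \<open>Traces\<close>

text \<open>On U_f' the map I_f' is I_f after the affine transition, so an extension of I_f in a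
  chart, composed with the affine map, extends I_f', and the chain rule applies in each
  chart.\<close>

lemma dparam_transition:
  assumes f: "f \<in> cells X" and f': "f' \<in> cells X" "closure f' \<subseteq> closure f"
    and L: "linear L" "\<And>x. x \<in> Rd (cdim X f') \<Longrightarrow> L x \<in> Rd (cdim X f)"
    and T: "\<And>x. x \<in> pdom X f' \<Longrightarrow> coord X f (param X f' x) = L x + b"
    and y: "y \<in> pdom X f'" and w: "w \<in> Rd (cdim X f')"
  shows "dparam X f' y w = dparam X f (L y + b) (L w)"
proof
  fix c :: "('a, 'n) chart"
  have in_f: "L z + b \<in> pdom X f" "param X f (L z + b) = param X f' z" if "z \<in> pdom X f'" for z
  proof -
    have "param X f' z \<in> closure f" using param_in[OF f'(1) that] f'(2) by blast
    then show "L z + b \<in> pdom X f" "param X f (L z + b) = param X f' z"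
      using coord_in[OF f] param_coord[OF f] T[OF that] by metis+
  qed
  obtain V \<phi> where c: "c = (V, \<phi>)" by (cases c)
  show "dparam X f' y w c = dparam X f (L y + b) (L w) c"
  proof (cases "c \<in> atlas X \<and> param X f' y \<in> V")
    case True
    then have V: "(V, \<phi>) \<in> atlas X" "param X f' y \<in> V" "param X f (L y + b) \<in> V"
      using in_f[OF y] by (auto simp: c)
    show ?thesis
    proof (rule param_extension[OF f V(1) in_f(1)[OF y] V(3)])
      fix N G assume N: "L y + b \<in> N" "C1_open N G"
        and G: "\<And>z. z \<in> N \<inter> {x \<in> pdom X f. param X f x \<in> V} \<Longrightarrow> G z = \<phi> (param X f z)"
      have Af: "C1_open UNIV (\<lambda>x. L x + b)" by (rule C1_open_affine[OF L(1)])
      have C: "C1_open (UNIV \<inter> (\<lambda>x. L x + b) -` N) (\<lambda>x. G (L x + b))"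
        by (rule C1_open_compose[OF Af N(2)])
      have 1: "dparam X f' y w (V, \<phi>) = frechet_derivative (\<lambda>x. G (L x + b)) (at y) w"
        by (rule dparam_chart[OF f'(1) V(1) y V(2) _ C _ w]) (use N in_f G in auto)
      have 2: "dparam X f (L y + b) (L w) (V, \<phi>) = frechet_derivative G (at (L y + b)) (L w)"
        by (rule dparam_chart[OF f V(1) in_f(1)[OF y] V(3) N _ L(2)[OF w]]) (rule G)
      have "((\<lambda>x. L x + b) has_derivative L) (at y)"
        using L(1) by (auto simp: linear_conv_bounded_linear intro!: derivative_eq_intros bounded_linear_imp_has_derivative)
      then have "((\<lambda>x. G (L x + b)) has_derivative (\<lambda>w. frechet_derivative G (at (L y + b)) (L w))) (at y)"
        by (rule has_derivative_compose[where f = "\<lambda>x. L x + b", OF _ C1_open_has_derivative[OF N(2,1)]])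
      then have "frechet_derivative (\<lambda>x. G (L x + b)) (at y) w = frechet_derivative G (at (L y + b)) (L w)"
        by (rule fun_cong[OF frechet_derivative_at[symmetric]])
      then show ?thesis unfolding c 1 2 .
    qed
  next
    case False
    then show ?thesis using in_f[OF y] by (auto simp: dparam_def c)
  qed
qed

text \<open>A tangent vector with coordinates w on f' has coordinates L w on f by
  \<open>dparam_transition\<close>; thus the trace is the pullback by the affine transition. Both
  sides are 0 off the closure of f' and its tangent spaces.\<close>

lemma form_trace_pull_coord:
  assumes f: "f \<in> cells X" and f': "f' \<in> cells X" "closure f' \<subseteq> closure f"
    and L: "linear L" "\<And>x. x \<in> Rd (cdim X f') \<Longrightarrow> L x \<in> Rd (cdim X f)"
    and T: "\<And>x. x \<in> pdom X f' \<Longrightarrow> coord X f (param X f' x) = L x + b"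
  shows "form_trace X f' (pull_coord X f \<alpha>) = pull_coord X f' (\<lambda>x vs. \<alpha> (L x + b) (map L vs))"
proof (intro ext)
  fix p vs
  show "form_trace X f' (pull_coord X f \<alpha>) p vs = pull_coord X f' (\<lambda>x vs. \<alpha> (L x + b) (map L vs)) p vs"
  proof (cases "p \<in> closure f' \<and> set vs \<subseteq> cell_tangent X f' p")
    case True
    then have p: "p \<in> closure f'" "p \<in> closure f" using f'(2) by auto
    define y where "y = coord X f' p"
    have y: "y \<in> pdom X f'" "param X f' y = p"
      using coord_in[OF f'(1) p(1)] param_coord[OF f'(1) p(1)] by (auto simp: y_def)
    have Ty: "coord X f p = L y + b" using T[OF y(1)] y(2) by simp
    have v: "v \<in> cell_tangent X f p \<and> dcoord X f p v = L (dcoord X f' p v)" if "v \<in> set vs" for v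
    proof -
      have vt: "v \<in> cell_tangent X f' p" using True that by blast
      let ?w = "dcoord X f' p v"
      have w: "?w \<in> Rd (cdim X f')" "dparam X f' y ?w = v"
        using dcoord_cell_tangent[OF f'(1) p(1) vt] by (auto simp: y_def)
      then have "v = dparam X f (coord X f p) (L ?w)"
        unfolding Ty using dparam_transition[OF f f' L T y(1) w(1)] by simp
      then show ?thesis
        using dcoord_dparam[OF f p(2) L(2)[OF w(1)]] L(2)[OF w(1)] by (auto simp: cell_tangent_def)
    qed
    then have "map (dcoord X f p) vs = map L (map (dcoord X f' p) vs)" by simp
    then have "\<alpha> (coord X f p) (map (dcoord X f p) vs) = \<alpha> (L y + b) (map L (map (dcoord X f' p) vs))"
      by (simp only: Ty)
    moreover have "set vs \<subseteq> cell_tangent X f p" using v by blast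
    ultimately show ?thesis
      using True p by (simp add: form_trace_def pull_coord_def y_def)
  next
    case False
    then show ?thesis by (auto simp: form_trace_def pull_coord_def)
  qed
qed

lemma form_trace_trimmed:
  assumes f: "f \<in> cells X" and f': "f' \<in> subcells X d' f" and r: "0 \<le> r" and \<omega>: "\<omega> \<in> trimmed X r l f"
  shows "form_trace X f' \<omega> \<in> trimmed X r l f'"
proof (rule subcell_transition[OF f f'])
  fix L b
  assume f'c: "f' \<in> cells X" "closure f' \<subseteq> closure f" and L: "linear L"
    "\<And>x. x \<in> Rd (cdim X f') \<Longrightarrow> L x \<in> Rd (cdim X f)" and b: "b \<in> Rd (cdim X f)"
    and T: "\<And>x. x \<in> pdom X f' \<Longrightarrow> coord X f (param X f' x) = L x + b"
  let ?d = "cdim X f" and ?e = "cdim X f'"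
  have trace: "form_trace X f' (pull_coord X f \<alpha>) = pull_coord X f' (\<lambda>x vs. \<alpha> (L x + b) (map L vs))" for \<alpha>
    by (rule form_trace_pull_coord[OF f f'c L T])
  consider "l < 0" | "l = 0" | m where "l = int (Suc m)"
    by (metis linorder_cases zero_less_imp_eq_int gr0_implies_Suc of_nat_0_less_iff)
  then show ?thesis
  proof cases
    case 1
    then show ?thesis using \<omega> by (auto simp: trimmed_def form_trace_def fun_eq_iff)
  next
    \<comment> \<open>In degree 0 there is neither a d part nor a kappa part, so preservation of the
      polynomial degree under affine pullback suffices.\<close>
    case 2
    then obtain \<alpha> where \<alpha>: "\<alpha> \<in> pform r 0 ?d" "\<omega> = pull_coord X f \<alpha>"
      using \<omega> by (auto simp: trimmed_0)
    have "form_trace X f' \<omega> = pull_coord X f' (affine_pull ?e L b \<alpha>)"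
      unfolding \<alpha>(2) trace by (rule pull_coord_cong[OF f'c(1)]) (simp add: affine_pull_def)
    then show ?thesis
      unfolding 2 trimmed_0 using pform_affine_pull[OF L b \<alpha>(1)] by blast
  next
    case 3
    obtain k where k: "r = int k" using r nonneg_int_cases by blast
    obtain \<alpha> \<beta> where ab: "\<alpha> \<in> pform (int k) m ?d" "\<beta> \<in> pform (int k - 1) (Suc (Suc m)) ?d"
      and \<omega>: "\<omega> = pull_coord X f (\<lambda>x vs. extd ?d \<alpha> x vs + koszul \<beta> x vs)"
      using \<omega> unfolding 3 k trimmed_Suc[OF f] by blast
    show ?thesis
    proof (rule affine_pull_trimmed[OF L b ab])
      fix \<alpha>' \<beta>'
      assume ab': "\<alpha>' \<in> pform (int k) m ?e" "\<beta>' \<in> pform (int k - 1) (Suc (Suc m)) ?e"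
        and eq: "\<And>x vs. x \<in> Rd ?e \<Longrightarrow> set vs \<subseteq> Rd ?e \<Longrightarrow>
          extd ?d \<alpha> (L x + b) (map L vs) + koszul \<beta> (L x + b) (map L vs)
            = extd ?e \<alpha>' x vs + koszul \<beta>' x vs"
      have "form_trace X f' \<omega> = pull_coord X f' (\<lambda>x vs. extd ?e \<alpha>' x vs + koszul \<beta>' x vs)"
        unfolding \<omega> trace by (rule pull_coord_cong[OF f'c(1)]) (rule eq)
      then show ?thesis unfolding 3 k trimmed_Suc[OF f'c(1)] using ab' by blast
    qed
  qed
qed

end

theorem lemma26:
  fixes X :: "('a::t2_space, 'n::{finite,linorder}) meshed_manifold"
    and l r :: int and d d' :: nat and f f' :: "'a set"
  assumes "compact_riemannian_manifold X"
    and "is_mesh X"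
    and "affine_compatible_coordinates X"
    and "d \<le> CARD('n)" and "f \<in> cells_of_dim X d"
    and "d' \<le> d" and "f' \<in> subcells X d' f"
    and "0 \<le> r"
  shows "form_trace X f' ` trimmed X r l f \<subseteq> trimmed X r l f'"
proof -
  interpret affine_mesh X
    by unfold_locales (use assms in \<open>auto simp: compact_riemannian_manifold_def\<close>)
  show ?thesis
    using form_trace_trimmed assms by (auto simp: cells_of_dim_def)
qed

end
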